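(* Let $q\in(1,\infty)$, $c\in(0,\infty)$ and fix $t_1\in\mathbb{T}$. Then the operator $x_1^*x_2=(x_1^*x_1)^{1/2}\,\tilde{x}_1^*\tilde{x}_2\,(x_2^*x_2)^{1/2}$ is a weighted shift on $\mathcal{H}_1$ and on $\mathcal{H}_2$ with respect to the orthonormal bases $\{v_{2n-1}\}_{n\ge 1}$ and $\{v_{2n}\}_{n\ge1}$ respectively. More precisely, for all $k\in\mathbb{N}=\{1,2,\dots\}$, $$(x_1^*x_2)(v_k)=\sqrt{c_{k+2}}\,\sqrt{1+q^{-2}c-q^{-2}c_k}\;v_{k+2},$$ where $(c_k)_{k\ge1}$ is defined by $c_1=0$, $c_2=1+c$, and $c_{k+2}=c-q^{-2}c+q^{-2}c_k$ for $k\in\mathbb{N}$.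
   Context: $\mathbb{Z}_{\ge}=\{0,1,2,\dots\}$, and $\{e_n\}_{n\ge 0}$ is the canonical orthonormal basis of $\ell^2(\mathbb{Z}_{\ge})$. The bounded operators $\alpha,\gamma$ on $\ell^2(\mathbb{Z}_{\ge})$ are given by $\alpha e_0=0$, $\alpha e_n=\sqrt{1-q^{-2n}}\,e_{n-1}$ for $n\ge 1$, and $\gamma e_n=q^{-n}e_n$ for $n\ge 0$. With $t_1\in\mathbb{T}$ fixed and $t_2:=\overline{t_1}$, put $x_1=\sqrt{c}\,t_1\alpha+t_2\gamma$ and $x_2=-q^{-1}\sqrt{c}\,t_1\gamma+t_2\alpha^*$ in $\mathcal{B}(\ell^2(\mathbb{Z}_{\ge}))$. Both are Fredholm; $x_1$ is surjective with one-dimensional kernel, $x_2$ is injective with one-dimensional cokernel. For a positive Fredholm operator $T$, $\underline{T^{-1/2}}$ denotes $f(T)$ (functional calculus) where $f(0)=0$ and $f(s)=s^{-1/2}$ for $s\in\mathrm{Sp}(T)\setminus\{0\}$. Put $\tilde{x}_i:=x_i\,\underline{(x_i^*x_i)^{-1/2}}$ for $i=1,2$. Let $v_1$ be a unit vector spanning $\ker(x_1)$, and let $v_2$ be a unit vector spanning the range of the rank-one projection $p_2:=\tilde{x}_1^*(1-\tilde{x}_2\tilde{x}_2^* )\tilde{x}_1$. For $i\in\{1,2\}$ and $n\ge0$ put $v_{i+2n}:=(\tilde{x}_1^*\tilde{x}_2)^n(v_i)$. The vectors $v_k$, $k\in\mathbb{N}$, are orthonormal, and $\mathcal{H}_i$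 ($i=1,2$) is the closed linear span of $\{v_{i+2n}: n\ge0\}$. *)

theory Defs
  imports "HOL-Analysis.Analysis" "HOL-Computational_Algebra.Polynomial"
begin

section \<open>The complex Hilbert space of square-summable sequences\<close>

typedef ell2 = "{x :: nat \<Rightarrow> complex. summable (\<lambda>n. (cmod (x n))\<^sup>2)}"
  morphisms coord Abs_ell2
  by (rule exI[of _ "\<lambda>_. 0"]) simp

setup_lifting type_definition_ell2

lemma ell2_eqI: "(\<And>n. coord x n = coord y n) \<Longrightarrow> x = y"
  by (simp add: coord_inject[symmetric] fun_eq_iff)

lemma summable_coord: "summable (\<lambda>n. (cmod (coord x n))\<^sup>2)"
  using coord[of x] by simp

lemma sq_summable_add:
  assumes "summable (\<lambda>n. (cmod (x n))\<^sup>2)" "summable (\<lambda>n. (cmod (y n))\<^sup>2)"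
  shows "summable (\<lambda>n. (cmod (x n + y n))\<^sup>2)"
proof (rule summable_comparison_test)
  have "(cmod (x n + y n))\<^sup>2 \<le> 2 * (cmod (x n))\<^sup>2 + 2 * (cmod (y n))\<^sup>2" for n
  proof -
    have "(cmod (x n + y n))\<^sup>2 \<le> (cmod (x n) + cmod (y n))\<^sup>2"
      by (intro power_mono norm_triangle_ineq) simp
    also have "\<dots> \<le> 2 * (cmod (x n))\<^sup>2 + 2 * (cmod (y n))\<^sup>2"
      using sum_squares_ge_zero[of "cmod (x n) - cmod (y n)" 0]
      by (simp add: power2_eq_square algebra_simps)
    finally show ?thesis .
  qed
  then show "\<exists>N. \<forall>n\<ge>N. norm ((cmod (x n + y n))\<^sup>2) \<le> 2 * (cmod (x n))\<^sup>2 + 2 * (cmod (y n))\<^sup>2"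
    by auto
  show "summable (\<lambda>n. 2 * (cmod (x n))\<^sup>2 + 2 * (cmod (y n))\<^sup>2)"
    by (intro summable_add summable_mult assms)
qed

lemma sq_summable_scale:
  "summable (\<lambda>n. (cmod (x n))\<^sup>2) \<Longrightarrow> summable (\<lambda>n. (cmod (a * x n))\<^sup>2)"
  by (simp add: norm_mult power_mult_distrib summable_mult)

lift_definition scaleC :: "complex \<Rightarrow> ell2 \<Rightarrow> ell2"  (infixr \<open>*\<^sub>C\<close> 75)
  is "\<lambda>a x n. a * x n"
  using sq_summable_scale by simp

lift_definition basis_vec :: "nat \<Rightarrow> ell2" is "\<lambda>k n. of_bool (n = k)"
proof -
  show "summable (\<lambda>n. (cmod (of_bool (n = k)))\<^sup>2)" for k :: nat
    by (rule summable_finite[of "{k}"]) auto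
qed

text \<open>Linear in the first argument.\<close>
definition cinner :: "ell2 \<Rightarrow> ell2 \<Rightarrow> complex" where
  "cinner x y = (\<Sum>n. coord x n * cnj (coord y n))"

lemma summable_cinner: "summable (\<lambda>n. coord x n * cnj (coord y n))"
proof (rule summable_comparison_test)
  have "cmod (coord x n) * cmod (coord y n)
      \<le> (cmod (coord x n))\<^sup>2 + (cmod (coord y n))\<^sup>2" for n
    using sum_squares_bound[of "cmod (coord x n)" "cmod (coord y n)"]
      mult_nonneg_nonneg[OF norm_ge_zero norm_ge_zero, of "coord x n" "coord y n"]
    by linarith
  then show "\<exists>N. \<forall>n\<ge>N. norm (coord x n * cnj (coord y n))
      \<le> (cmod (coord x n))\<^sup>2 + (cmod (coord y n))\<^sup>2"
    by (simp add: norm_mult)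
  show "summable (\<lambda>n. (cmod (coord x n))\<^sup>2 + (cmod (coord y n))\<^sup>2)"
    by (intro summable_add summable_coord)
qed

text \<open>The real structure of the type classes comes from the complex one: its inner product is the
  real part of \<^const>\<open>cinner\<close>, so that norm and topology are the usual ones.\<close>

instantiation ell2 :: real_inner
begin

lift_definition zero_ell2 :: ell2 is "\<lambda>_. 0" by simp
lift_definition plus_ell2 :: "ell2 \<Rightarrow> ell2 \<Rightarrow> ell2" is "\<lambda>x y n. x n + y n"
  using sq_summable_add by simp
lift_definition uminus_ell2 :: "ell2 \<Rightarrow> ell2" is "\<lambda>x n. - x n" by simp
definition minus_ell2 :: "ell2 \<Rightarrow> ell2 \<Rightarrow> ell2" where "x - y = x + - (y :: ell2)"
definition scaleR_ell2 :: "real \<Rightarrow> ell2 \<Rightarrow> ell2" where "scaleR_ell2 r x = complex_of_real r *\<^sub>C x"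
definition inner_ell2 :: "ell2 \<Rightarrow> ell2 \<Rightarrow> real" where "inner_ell2 x y = Re (cinner x y)"
definition norm_ell2 :: "ell2 \<Rightarrow> real" where "norm_ell2 x = sqrt (inner x x)"
definition sgn_ell2 :: "ell2 \<Rightarrow> ell2" where "sgn_ell2 x = inverse (norm x) *\<^sub>R x"
definition dist_ell2 :: "ell2 \<Rightarrow> ell2 \<Rightarrow> real" where "dist_ell2 x y = norm (x - y)"
definition uniformity_ell2 :: "(ell2 \<times> ell2) filter" where
  "uniformity_ell2 = (INF e\<in>{0<..}. principal {(x, y). dist x y < e})"
definition open_ell2 :: "ell2 set \<Rightarrow> bool" where
  "open_ell2 U = (\<forall>x\<in>U. \<forall>\<^sub>F (x', y) in uniformity. x' = x \<longrightarrow> y \<in> U)"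

instance
proof
  fix x y z :: ell2 and r s :: real
  note coord_simps = plus_ell2.rep_eq uminus_ell2.rep_eq zero_ell2.rep_eq scaleC.rep_eq
  show "x + y + z = x + (y + z)" "x + y = y + x" "0 + x = x" "- x + x = 0" "x - y = x + - y"
    "r *\<^sub>R (x + y) = r *\<^sub>R x + r *\<^sub>R y" "(r + s) *\<^sub>R x = r *\<^sub>R x + s *\<^sub>R x"
    "r *\<^sub>R s *\<^sub>R x = (r * s) *\<^sub>R x" "1 *\<^sub>R x = x"
    by (auto intro!: ell2_eqI simp: coord_simps scaleR_ell2_def minus_ell2_def algebra_simps)
  have re: "inner u w = (\<Sum>n. Re (coord u n * cnj (coord w n)))"
    and sre: "summable (\<lambda>n. Re (coord u n * cnj (coord w n)))" for u w :: ell2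
    using summable_cinner[of u w] by (simp_all only: inner_ell2_def cinner_def Re_suminf summable_Re)
  show "inner x y = inner y x"
    unfolding re by (simp add: algebra_simps)
  have dist: "Re (coord (x + y) n * cnj (coord z n))
      = Re (coord x n * cnj (coord z n)) + Re (coord y n * cnj (coord z n))" for n
    by (simp add: coord_simps algebra_simps)
  show "inner (x + y) z = inner x z + inner y z"
    unfolding re dist by (rule suminf_add[symmetric]) (rule sre)+
  have scale: "Re (coord (r *\<^sub>R x) n * cnj (coord y n)) = r * Re (coord x n * cnj (coord y n))" for n
    by (simp add: scaleR_ell2_def coord_simps algebra_simps)
  show "inner (r *\<^sub>R x) y = r * inner x y"
    unfolding re scale by (rule suminf_mult) (rule sre)
  have sq: "Re (coord x n * cnj (coord x n)) = (cmod (coord x n))\<^sup>2" for n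
    by (simp add: cmod_power2) (simp add: power2_eq_square)
  show "0 \<le> inner x x"
    unfolding re sq by (rule suminf_nonneg) (auto intro: summable_coord)
  show "inner x x = 0 \<longleftrightarrow> x = 0"
  proof -
    have "inner x x = 0 \<longleftrightarrow> (\<forall>n. (cmod (coord x n))\<^sup>2 = 0)"
      unfolding re sq by (rule suminf_eq_zero_iff) (auto intro: summable_coord)
    also have "\<dots> \<longleftrightarrow> x = 0"
      by (auto intro!: ell2_eqI simp: zero_ell2.rep_eq)
    finally show ?thesis .
  qed
qed (simp_all only: norm_ell2_def sgn_ell2_def dist_ell2_def uniformity_ell2_def open_ell2_def)

end

lemma coord_simps [simp]:
  "coord 0 n = 0"
  "coord (x + y) n = coord x n + coord y n"
  "coord (- x) n = - coord x n"
  "coord (x - y) n = coord x n - coord y n"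
  "coord (a *\<^sub>C x) n = a * coord x n"
  "coord (r *\<^sub>R x) n = r *\<^sub>R coord x n"
  "coord (basis_vec k) n = of_bool (n = k)"
  unfolding minus_ell2_def scaleR_ell2_def
  by (simp_all only: zero_ell2.rep_eq plus_ell2.rep_eq uminus_ell2.rep_eq scaleC.rep_eq
      basis_vec.rep_eq scaleR_conv_of_real diff_conv_add_uminus)

lemma norm_ell2_sq: "(norm (x :: ell2))\<^sup>2 = (\<Sum>n. (cmod (coord x n))\<^sup>2)"
proof -
  have "(norm x)\<^sup>2 = (\<Sum>n. Re (coord x n * cnj (coord x n)))"
    unfolding power2_norm_eq_inner inner_ell2_def cinner_def
    by (rule Re_suminf[OF summable_cinner])
  also have "\<dots> = (\<Sum>n. (cmod (coord x n))\<^sup>2)"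
    by (simp add: cmod_power2) (simp add: power2_eq_square)
  finally show ?thesis .
qed

instance ell2 :: banach
proof
  fix X :: "nat \<Rightarrow> ell2"
  assume X: "Cauchy X"
  have partial_le: "(\<Sum>n<N. (cmod (coord x n))\<^sup>2) \<le> (norm x)\<^sup>2" for x N
    unfolding norm_ell2_sq by (rule sum_le_suminf) (auto intro: summable_coord)
  have coord_le: "cmod (coord x n) \<le> norm x" for x n
  proof (rule power2_le_imp_le)
    show "(cmod (coord x n))\<^sup>2 \<le> (norm x)\<^sup>2"
    proof -
      have "0 \<le> (\<Sum>i<n. (cmod (coord x i))\<^sup>2)"
        by (simp add: sum_nonneg)
      then show ?thesis
        using partial_le[of x "Suc n"] unfolding sum.lessThan_Suc by linarith
    qed
  qed simp
  have "Cauchy (\<lambda>k. coord (X k) n)" for n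
  proof (rule metric_CauchyI)
    fix e :: real assume "e > 0"
    then obtain M where "\<forall>m\<ge>M. \<forall>k\<ge>M. dist (X m) (X k) < e"
      using metric_CauchyD[OF X, of e] by blast
    moreover have "dist (coord (X m) n) (coord (X k) n) \<le> dist (X m) (X k)" for m k
      using coord_le[of "X m - X k" n] by (simp add: dist_norm)
    ultimately show "\<exists>M. \<forall>m\<ge>M. \<forall>k\<ge>M. dist (coord (X m) n) (coord (X k) n) < e"
      by (meson le_less_trans)
  qed
  then have "\<forall>n. \<exists>l. (\<lambda>k. coord (X k) n) \<longlonglongrightarrow> l"
    using Cauchy_convergent convergent_def by blast
  then obtain l where l: "\<And>n. (\<lambda>k. coord (X k) n) \<longlonglongrightarrow> l n"
    by metis
  obtain B where B: "\<And>k. norm (X k) \<le> B"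
    using Cauchy_Bseq[OF X] by (auto simp: Bseq_def)
  have "summable (\<lambda>n. (cmod (l n))\<^sup>2)"
  proof (rule summableI_nonneg_bounded)
    fix N
    have "(\<lambda>k. \<Sum>n<N. (cmod (coord (X k) n))\<^sup>2) \<longlonglongrightarrow> (\<Sum>n<N. (cmod (l n))\<^sup>2)"
      by (intro tendsto_intros l)
    moreover have "(\<Sum>n<N. (cmod (coord (X k) n))\<^sup>2) \<le> B\<^sup>2" for k
      by (rule order_trans[OF partial_le power_mono[OF B]]) simp
    ultimately show "(\<Sum>n<N. (cmod (l n))\<^sup>2) \<le> B\<^sup>2"
      by (auto intro: LIMSEQ_le_const2)
  qed simp
  then have L: "coord (Abs_ell2 l) n = l n" for n
    by (simp add: Abs_ell2_inverse)
  have "X \<longlonglongrightarrow> Abs_ell2 l"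
  proof (rule metric_LIMSEQ_I)
    fix e :: real assume "e > 0"
    then obtain M where M: "\<And>m k. m \<ge> M \<Longrightarrow> k \<ge> M \<Longrightarrow> dist (X m) (X k) < e / 2"
      using metric_CauchyD[OF X, of "e / 2"] by auto
    have "dist (X m) (Abs_ell2 l) < e" if "m \<ge> M" for m
    proof -
      have "(\<Sum>n<N. (cmod (coord (X m) n - l n))\<^sup>2) \<le> (e / 2)\<^sup>2" for N
      proof (rule LIMSEQ_le_const2)
        show "(\<lambda>k. \<Sum>n<N. (cmod (coord (X m) n - coord (X k) n))\<^sup>2)
            \<longlonglongrightarrow> (\<Sum>n<N. (cmod (coord (X m) n - l n))\<^sup>2)"
          by (intro tendsto_intros l)
        have "(\<Sum>n<N. (cmod (coord (X m - X k) n))\<^sup>2) \<le> (e / 2)\<^sup>2" if "k \<ge> M" for k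
          using M[OF \<open>m \<ge> M\<close> that]
          by (intro order_trans[OF partial_le power_mono]) (auto simp: dist_norm)
        then show "\<exists>N'. \<forall>k\<ge>N'. (\<Sum>n<N. (cmod (coord (X m) n - coord (X k) n))\<^sup>2) \<le> (e / 2)\<^sup>2"
          by auto
      qed
      then have "(norm (X m - Abs_ell2 l))\<^sup>2 \<le> (e / 2)\<^sup>2"
        using summable_coord[of "X m - Abs_ell2 l"]
        by (auto simp: norm_ell2_sq L intro!: suminf_le_const)
      then have "norm (X m - Abs_ell2 l) \<le> e / 2"
        by (rule power2_le_imp_le) (use \<open>e > 0\<close> in simp)
      then show ?thesis
        using \<open>e > 0\<close> by (simp add: dist_norm)
    qed
    then show "\<exists>M. \<forall>m\<ge>M. dist (X m) (Abs_ell2 l) < e"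
      by blast
  qed
  then show "convergent X"
    by (auto simp: convergent_def)
qed

interpretation ell2: vector_space "(*\<^sub>C)"
  by unfold_locales (auto intro!: ell2_eqI simp: algebra_simps)


section \<open>Bounded operators\<close>

definition bounded_op :: "(ell2 \<Rightarrow> ell2) \<Rightarrow> bool" where
  "bounded_op T \<longleftrightarrow> bounded_linear T \<and> (\<forall>a x. T (a *\<^sub>C x) = a *\<^sub>C T x)"

definition adj :: "(ell2 \<Rightarrow> ell2) \<Rightarrow> ell2 \<Rightarrow> ell2" where
  "adj T = (THE S. \<forall>x y. cinner (T x) y = cinner x (S y))"

definition spectrum :: "(ell2 \<Rightarrow> ell2) \<Rightarrow> complex set" where
  "spectrum T = {z. \<not> (\<exists>S. bounded_op S \<and> (\<forall>x. S (T x - z *\<^sub>C x) = x) \<and>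
                                          (\<forall>x. T (S x) - z *\<^sub>C S x = x))}"

definition poly_op :: "real poly \<Rightarrow> (ell2 \<Rightarrow> ell2) \<Rightarrow> ell2 \<Rightarrow> ell2" where
  "poly_op p T x = (\<Sum>i\<le>degree p. coeff p i *\<^sub>R (T ^^ i) x)"

text \<open>Continuous functional calculus for a self-adjoint bounded operator \<open>T\<close> (whose spectrum is a
  compact set of reals) and a real function \<open>f\<close> that is continuous on the spectrum: \<open>f(T)\<close> is the
  limit in operator norm of \<open>p\<^sub>n(T)\<close> for polynomials \<open>p\<^sub>n\<close> tending to \<open>f\<close> uniformly on
  the spectrum.\<close>
definition fun_calc :: "(real \<Rightarrow> real) \<Rightarrow> (ell2 \<Rightarrow> ell2) \<Rightarrow> ell2 \<Rightarrow> ell2" where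
  "fun_calc f T = (THE S. bounded_op S \<and>
     (\<exists>p. uniform_limit {s. complex_of_real s \<in> spectrum T} (\<lambda>n. poly (p n)) f sequentially \<and>
          (\<lambda>n. onorm (\<lambda>x. poly_op (p n) T x - S x)) \<longlonglongrightarrow> 0))"

definition sqrt_op :: "(ell2 \<Rightarrow> ell2) \<Rightarrow> ell2 \<Rightarrow> ell2" where
  "sqrt_op = fun_calc sqrt"

text \<open>Meant for positive Fredholm operators: \<open>0\<close> is then at most an isolated point of the
  spectrum, so the function is continuous on the spectrum.\<close>
definition inv_sqrt_op :: "(ell2 \<Rightarrow> ell2) \<Rightarrow> ell2 \<Rightarrow> ell2" where
  "inv_sqrt_op = fun_calc (\<lambda>s. if s = 0 then 0 else s powr (- 1 / 2))"

definition isometric_part :: "(ell2 \<Rightarrow> ell2) \<Rightarrow> ell2 \<Rightarrow> ell2" where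
  "isometric_part T = T \<circ> inv_sqrt_op (adj T \<circ> T)"

definition orthonormal_basis_of :: "(nat \<Rightarrow> ell2) \<Rightarrow> ell2 set \<Rightarrow> bool" where
  "orthonormal_basis_of b H \<longleftrightarrow>
     (\<forall>m n. cinner (b m) (b n) = of_bool (m = n)) \<and> closure (ell2.span (range b)) = H"

definition weighted_shift_on :: "ell2 set \<Rightarrow> (nat \<Rightarrow> ell2) \<Rightarrow> (ell2 \<Rightarrow> ell2) \<Rightarrow> bool" where
  "weighted_shift_on H b T \<longleftrightarrow>
     orthonormal_basis_of b H \<and> bounded_op T \<and> T ` H \<subseteq> H \<and>
     (\<exists>w :: nat \<Rightarrow> complex. bounded (range w) \<and> (\<forall>n. T (b n) = w n *\<^sub>C b (Suc n)))"


section \<open>The operators\<close>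

definition alpha :: "real \<Rightarrow> ell2 \<Rightarrow> ell2" where
  "alpha q x = Abs_ell2 (\<lambda>n. complex_of_real (sqrt (1 - 1 / q ^ (2 * (n + 1)))) * coord x (n + 1))"

definition gamma :: "real \<Rightarrow> ell2 \<Rightarrow> ell2" where
  "gamma q x = Abs_ell2 (\<lambda>n. complex_of_real (1 / q ^ n) * coord x n)"

lemma sq_summable_mult_bounded:
  fixes w x :: "nat \<Rightarrow> complex"
  assumes "\<And>n. cmod (w n) \<le> 1" "summable (\<lambda>n. (cmod (x n))\<^sup>2)"
  shows "summable (\<lambda>n. (cmod (w n * x n))\<^sup>2)"
    and "(\<Sum>n. (cmod (w n * x n))\<^sup>2) \<le> (\<Sum>n. (cmod (x n))\<^sup>2)"
proof -
  have le: "(cmod (w n * x n))\<^sup>2 \<le> (cmod (x n))\<^sup>2" for n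
    by (rule power_mono) (use assms(1) in \<open>auto simp: norm_mult intro: mult_left_le_one_le\<close>)
  show *: "summable (\<lambda>n. (cmod (w n * x n))\<^sup>2)"
    by (rule summable_comparison_test[OF _ assms(2)]) (use le in auto)
  show "(\<Sum>n. (cmod (w n * x n))\<^sup>2) \<le> (\<Sum>n. (cmod (x n))\<^sup>2)"
    by (rule suminf_le[OF le * assms(2)])
qed

lemma alpha_weight_le_1:
  assumes "q > 1"
  shows "cmod (complex_of_real (sqrt (1 - 1 / q ^ (2 * (n + 1))))) \<le> 1"
proof -
  have "1 / q ^ (2 * (n + 1)) \<le> 1"
    using assms by (simp add: one_le_power del: power_Suc power_add)
  moreover have "0 \<le> 1 / q ^ (2 * (n + 1))"
    using assms by simp
  ultimately show ?thesis
    by (simp add: norm_of_real)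
qed

lemma gamma_weight_le_1: "q > 1 \<Longrightarrow> cmod (complex_of_real (1 / q ^ n)) \<le> 1"
  by (simp add: norm_divide norm_power one_le_power)

lemma coord_alpha:
  assumes "q > 1"
  shows "coord (alpha q x) n = complex_of_real (sqrt (1 - 1 / q ^ (2 * (n + 1)))) * coord x (n + 1)"
proof -
  have "summable (\<lambda>n. (cmod (coord x (n + 1)))\<^sup>2)"
    using summable_ignore_initial_segment[OF summable_coord, of x 1] .
  from sq_summable_mult_bounded(1)[OF alpha_weight_le_1[OF assms] this]
  show ?thesis
    unfolding alpha_def by (subst Abs_ell2_inverse) auto
qed

lemma coord_gamma:
  assumes "q > 1"
  shows "coord (gamma q x) n = complex_of_real (1 / q ^ n) * coord x n"
  using sq_summable_mult_bounded(1)[OF gamma_weight_le_1[OF assms] summable_coord[of x]]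
  unfolding gamma_def by (subst Abs_ell2_inverse) auto

lemma alpha_basis:
  assumes "q > 1"
  shows "alpha q (basis_vec 0) = 0"
    and "n \<ge> 1 \<Longrightarrow> alpha q (basis_vec n)
           = complex_of_real (sqrt (1 - 1 / q ^ (2 * n))) *\<^sub>C basis_vec (n - 1)"
  by (cases n; auto intro!: ell2_eqI simp: coord_alpha[OF assms])+

lemma gamma_basis:
  "q > 1 \<Longrightarrow> gamma q (basis_vec n) = complex_of_real (1 / q ^ n) *\<^sub>C basis_vec n"
  by (auto intro!: ell2_eqI simp: coord_gamma)

lemma bounded_op_alpha:
  assumes "q > 1"
  shows "bounded_op (alpha q)"
proof -
  have "norm (alpha q x) \<le> norm x" for x
  proof -
    have s: "summable (\<lambda>n. (cmod (coord x (n + 1)))\<^sup>2)"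
      using summable_ignore_initial_segment[OF summable_coord, of x 1] .
    have "(norm (alpha q x))\<^sup>2 \<le> (\<Sum>n. (cmod (coord x (n + 1)))\<^sup>2)"
      using sq_summable_mult_bounded(2)[OF alpha_weight_le_1[OF assms] s]
      by (simp add: norm_ell2_sq coord_alpha[OF assms])
    also have "\<dots> \<le> (norm x)\<^sup>2"
      using suminf_split_head[OF summable_coord, of x] by (simp add: norm_ell2_sq)
    finally show ?thesis
      by (rule power2_le_imp_le) simp
  qed
  then show ?thesis
    unfolding bounded_op_def
    by (intro conjI allI bounded_linear_intro[where K = 1] ell2_eqI)
       (simp_all add: coord_alpha[OF assms] algebra_simps)
qed

lemma bounded_op_gamma:
  assumes "q > 1"
  shows "bounded_op (gamma q)"
proof -
  have "norm (gamma q x) \<le> norm x" for x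
  proof (rule power2_le_imp_le)
    show "(norm (gamma q x))\<^sup>2 \<le> (norm x)\<^sup>2"
      using sq_summable_mult_bounded(2)[OF gamma_weight_le_1[OF assms] summable_coord[of x]]
      by (simp add: norm_ell2_sq coord_gamma[OF assms])
  qed simp
  then show ?thesis
    unfolding bounded_op_def
    by (intro conjI allI bounded_linear_intro[where K = 1] ell2_eqI)
       (simp_all add: coord_gamma[OF assms] scaleR_conv_of_real algebra_simps)
qed

definition x1 :: "real \<Rightarrow> real \<Rightarrow> complex \<Rightarrow> ell2 \<Rightarrow> ell2" where
  "x1 q c t1 \<xi> = (complex_of_real (sqrt c) * t1) *\<^sub>C alpha q \<xi> + cnj t1 *\<^sub>C gamma q \<xi>"

definition x2 :: "real \<Rightarrow> real \<Rightarrow> complex \<Rightarrow> ell2 \<Rightarrow> ell2" where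
  "x2 q c t1 \<xi> = (- complex_of_real (sqrt c / q) * t1) *\<^sub>C gamma q \<xi> + cnj t1 *\<^sub>C adj (alpha q) \<xi>"

abbreviation x1t :: "real \<Rightarrow> real \<Rightarrow> complex \<Rightarrow> ell2 \<Rightarrow> ell2" where
  "x1t q c t1 \<equiv> isometric_part (x1 q c t1)"

abbreviation x2t :: "real \<Rightarrow> real \<Rightarrow> complex \<Rightarrow> ell2 \<Rightarrow> ell2" where
  "x2t q c t1 \<equiv> isometric_part (x2 q c t1)"

definition p2 :: "real \<Rightarrow> real \<Rightarrow> complex \<Rightarrow> ell2 \<Rightarrow> ell2" where
  "p2 q c t1 = adj (x1t q c t1) \<circ> (\<lambda>\<xi>. \<xi> - x2t q c t1 (adj (x2t q c t1) \<xi>)) \<circ> x1t q c t1"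

end

theory Submission
  imports Defs "HOL-Computational_Algebra.Fundamental_Theorem_Algebra"
begin

text \<open>
  Everything rests on two identities that tie \<open>x\<^sub>1\<close> to \<open>x\<^sub>2\<close> (\<open>sum_of_ranges\<close>, \<open>sum_of_supports\<close>):
  \<open>x\<^sub>1 x\<^sub>1\<^sup>* + x\<^sub>2 x\<^sub>2\<^sup>* = 1 + c\<close> and \<open>x\<^sub>2\<^sup>* x\<^sub>2 + q\<^sup>-\<^sup>2 x\<^sub>1\<^sup>* x\<^sub>1 = 1 + q\<^sup>-\<^sup>2 c\<close>. Suppose \<open>v\<close> is an
  eigenvector of \<open>x\<^sub>1\<^sup>* x\<^sub>1\<close> for the eigenvalue \<open>k\<close>. The second identity makes \<open>v\<close> an eigenvector of
  \<open>x\<^sub>2\<^sup>* x\<^sub>2\<close> for \<open>a = 1 + q\<^sup>-\<^sup>2 c - q\<^sup>-\<^sup>2 k\<close>, so \<open>x\<^sub>2 v\<close> is one of \<open>x\<^sub>2 x\<^sub>2\<^sup>*\<close> for \<open>a\<close>; the first identity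
  makes \<open>x\<^sub>2 v\<close> an eigenvector of \<open>x\<^sub>1 x\<^sub>1\<^sup>*\<close> for \<open>k' = 1 + c - a = c - q\<^sup>-\<^sup>2 c + q\<^sup>-\<^sup>2 k\<close>, and \<open>x\<^sub>1\<^sup>* x\<^sub>2 v\<close> is an
  eigenvector of \<open>x\<^sub>1\<^sup>* x\<^sub>1\<close> for \<open>k'\<close>. This is the recursion for \<open>c\<^sub>k\<close>. On these vectors
  the isometric part of \<open>x\<^sub>2\<close> is \<open>x\<^sub>2\<close> up to the scalar \<open>1 / \<surd>a\<close>, and the adjoint of the isometric part of \<open>x\<^sub>1\<close> is
  \<open>x\<^sub>1\<^sup>*\<close> up to \<open>1 / \<surd>k'\<close>, which yields the weights
  (\<open>eigenvector_step\<close>). The two chains start in \<open>ker x\<^sub>1\<close>, with eigenvalue \<open>0\<close>, and in the range of \<open>p\<^sub>2\<close>, which comes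
  from \<open>ker x\<^sub>2\<^sup>*\<close> and has eigenvalue \<open>1 + c\<close> (\<open>range_p2_eigenvector\<close>). Within a chain the
  eigenvalues are distinct, hence the vectors orthogonal (\<open>weighted_shift_chain\<close>).

  The square roots are limits of polynomials that converge uniformly on the spectrum. For them to exist, to be
  unique and to be multiplicative, one needs \<open>\<parallel>p(T)\<parallel> \<le> sup \<bar>p\<bar>\<close> over the real spectrum of a self-adjoint
  \<open>T\<close> (\<open>norm_poly_op_le\<close>). This follows from approximate eigenvectors: \<open>p(T)\<^sup>2 - \<parallel>p(T)\<parallel>\<^sup>2\<close> is not bounded below,
  so one of its linear factors \<open>T - z\<close> is not, which forces \<open>z\<close> to be a real point of the spectrum with
  \<open>\<bar>p(z)\<bar> = \<parallel>p(T)\<parallel>\<close>. The inverse square root is continuous on the spectrum if the latter has a gap next to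
  \<open>0\<close>; the same two identities provide it (\<open>gap1\<close>, \<open>gap2\<close>). The factorization of \<open>x\<^sub>1\<^sup>* x\<^sub>2\<close> is
  then the polar decomposition of \<open>x\<^sub>1\<^sup>*\<close> and of \<open>x\<^sub>2\<close>.
\<close>

section \<open>Bounded complex-linear operators\<close>

lemma cinner_scaleC_left: "cinner (a *\<^sub>C x) y = a * cinner x y"
  unfolding cinner_def
  by (subst suminf_mult[OF summable_cinner, symmetric]) (simp add: mult.assoc)

lemma cinner_scaleC_right: "cinner x (a *\<^sub>C y) = cnj a * cinner x y"
  unfolding cinner_def
  by (subst suminf_mult[OF summable_cinner, symmetric]) (simp add: mult_ac)

lemma inner_scaleC_left: "inner (a *\<^sub>C x) y = inner x (cnj a *\<^sub>C y)"
  by (simp add: inner_ell2_def cinner_scaleC_left cinner_scaleC_right)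

lemma cinner_eq_inner: "cinner x y = Complex (inner x y) (inner x (\<i> *\<^sub>C y))"
  by (simp add: inner_ell2_def cinner_scaleC_right)

lemma norm_scaleC: "norm (a *\<^sub>C (x :: ell2)) = cmod a * norm x"
proof (rule power2_eq_imp_eq)
  have "cnj a * a = of_real ((cmod a)\<^sup>2)"
    by (metis complex_norm_square mult.commute)
  then have "(norm (a *\<^sub>C x))\<^sup>2 = Re (of_real ((cmod a)\<^sup>2) * cinner x x)"
    by (simp add: power2_norm_eq_inner inner_ell2_def cinner_scaleC_left cinner_scaleC_right
        flip: mult.assoc)
  then show "(norm (a *\<^sub>C x))\<^sup>2 = (cmod a * norm x)\<^sup>2"
    by (simp add: power2_norm_eq_inner inner_ell2_def power_mult_distrib Re_complex_of_real)
qed simp_all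

lemma scaleC_of_real: "complex_of_real r *\<^sub>C x = r *\<^sub>R x"
  by (simp add: scaleR_ell2_def)

lemma scaleC_add_right: "a *\<^sub>C (x + y) = a *\<^sub>C x + a *\<^sub>C y"
  by (rule ell2.scale_right_distrib)

lemma bounded_linear_scaleC: "bounded_linear (\<lambda>x :: ell2. a *\<^sub>C x)"
  by (rule bounded_linear_intro[where K = "cmod a"])
     (auto intro!: ell2_eqI simp: norm_scaleC scaleR_conv_of_real algebra_simps)

lemma bounded_op_bounded_linear: "bounded_op T \<Longrightarrow> bounded_linear T"
  by (simp add: bounded_op_def)

lemma bounded_op_scaleC: "bounded_op T \<Longrightarrow> T (a *\<^sub>C x) = a *\<^sub>C T x"
  by (simp add: bounded_op_def)

lemma
  assumes "bounded_op T"
  shows bounded_op_add: "T (x + y) = T x + T y"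
    and bounded_op_diff: "T (x - y) = T x - T y"
    and bounded_op_scaleR: "T (r *\<^sub>R x) = r *\<^sub>R T x"
    and bounded_op_zero: "T 0 = 0"
  using bounded_op_bounded_linear[OF assms]
  by (simp_all add: linear_simps)

lemma bounded_op_ident: "bounded_op (\<lambda>x. x)"
  by (simp add: bounded_op_def)

lemma bounded_op_comp: "bounded_op S \<Longrightarrow> bounded_op T \<Longrightarrow> bounded_op (\<lambda>x. S (T x))"
  unfolding bounded_op_def by (auto intro: bounded_linear_compose)

lemma bounded_op_plus: "bounded_op S \<Longrightarrow> bounded_op T \<Longrightarrow> bounded_op (\<lambda>x. S x + T x)"
  unfolding bounded_op_def by (auto intro: bounded_linear_add simp: scaleC_add_right)

lemma bounded_op_scaleC_op: "bounded_op T \<Longrightarrow> bounded_op (\<lambda>x. a *\<^sub>C T x)"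
  unfolding bounded_op_def
  by (auto intro: bounded_linear_compose[OF bounded_linear_scaleC] simp: mult.commute)

lemma bounded_op_scaleR_op: "bounded_op T \<Longrightarrow> bounded_op (\<lambda>x. r *\<^sub>R T x)"
  using bounded_op_scaleC_op[of T "of_real r"] by (simp add: scaleC_of_real)

lemma bounded_op_minus: "bounded_op S \<Longrightarrow> bounded_op T \<Longrightarrow> bounded_op (\<lambda>x. S x - T x)"
  using bounded_op_plus[OF _ bounded_op_scaleR_op[of T "-1"], of S] by simp

lemma bounded_op_zero_op: "bounded_op (\<lambda>x. 0)"
  by (simp add: bounded_op_def)

lemma bounded_op_sum: "(\<And>i. i \<in> I \<Longrightarrow> bounded_op (T i)) \<Longrightarrow> bounded_op (\<lambda>x. \<Sum>i\<in>I. T i x)"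
  by (induction I rule: infinite_finite_induct)
     (auto intro: bounded_op_zero_op bounded_op_plus)

lemma bounded_op_funpow: "bounded_op T \<Longrightarrow> bounded_op (T ^^ n)"
  by (induction n) (simp_all add: bounded_op_ident bounded_op_comp id_def o_def)

lemma bounded_op_poly_op: "bounded_op T \<Longrightarrow> bounded_op (poly_op p T)"
  unfolding poly_op_def by (intro bounded_op_sum bounded_op_scaleR_op bounded_op_funpow)

lemmas bounded_op_intros = bounded_op_ident bounded_op_plus bounded_op_minus
  bounded_op_scaleC_op bounded_op_scaleR_op


section \<open>Adjoints\<close>

text \<open>For complex-linear maps adjointness with respect to the real inner product \<open>Re \<langle>x, y\<rangle>\<close> is
  the same as adjointness with respect to \<open>\<langle>x, y\<rangle>\<close>, because \<open>Im \<langle>x, y\<rangle> = Re \<langle>x, \<i> y\<rangle>\<close>. The real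
  version gives access to the theory of real inner product spaces.\<close>
definition adjoint_pair :: "(ell2 \<Rightarrow> ell2) \<Rightarrow> (ell2 \<Rightarrow> ell2) \<Rightarrow> bool" where
  "adjoint_pair S T \<longleftrightarrow> bounded_op S \<and> bounded_op T \<and> (\<forall>x y. inner (S x) y = inner x (T y))"

abbreviation selfadjoint :: "(ell2 \<Rightarrow> ell2) \<Rightarrow> bool" where
  "selfadjoint T \<equiv> adjoint_pair T T"

lemma adjoint_pairD:
  assumes "adjoint_pair S T"
  shows "bounded_op S" "bounded_op T" "inner (S x) y = inner x (T y)"
  using assms by (simp_all add: adjoint_pair_def)

lemma adjoint_pair_sym: "adjoint_pair S T \<Longrightarrow> adjoint_pair T S"
  unfolding adjoint_pair_def by (metis inner_commute)

text \<open>Each operator below comes with a formula for its adjoint, so the non-degeneracy of the inner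
  product is what identifies \<^const>\<open>adj\<close>.\<close>
lemma adj_eqI:
  assumes "adjoint_pair S T"
  shows "adj S = T"
  unfolding adj_def
proof (rule the_equality)
  show "\<forall>x y. cinner (S x) y = cinner x (T y)"
    using assms by (simp add: adjoint_pair_def cinner_eq_inner bounded_op_scaleC flip: bounded_op_scaleC)
next
  fix S' assume S': "\<forall>x y. cinner (S x) y = cinner x (S' y)"
  show "S' = T"
  proof
    fix y
    have "inner x (S' y) = inner x (T y)" for x
      using S' adjoint_pairD(3)[OF assms, of x y] by (metis inner_ell2_def)
    then have "inner (S' y - T y) (S' y - T y) = 0"
      by (simp add: inner_diff_right)
    then show "S' y = T y" by simp
  qed
qed

text \<open>A map adjoint to a bounded operator is itself linear, since it is determined by its inner
  products, and bounded: \<open>\<parallel>T x\<parallel>\<^sup>2 = \<langle>S T x, x\<rangle> \<le> K \<parallel>T x\<parallel> \<parallel>x\<parallel>\<close>.\<close>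
lemma adjoint_pairI:
  assumes S: "bounded_op S" and adj: "\<And>x y. inner (S x) y = inner x (T y)"
  shows "adjoint_pair S T"
proof -
  have eqI: "u = v" if "\<And>z. inner z u = inner z v" for u v :: ell2
  proof -
    have "inner (u - v) (u - v) = 0"
      using that[of "u - v"] unfolding inner_diff_right[of "u - v" u v] by simp
    then show ?thesis by simp
  qed
  obtain K where K: "K > 0" "\<And>x. norm (S x) \<le> norm x * K"
    using bounded_linear.pos_bounded[OF bounded_op_bounded_linear[OF S]] by blast
  have "bounded_op T"
    unfolding bounded_op_def
  proof (intro conjI allI bounded_linear_intro[where K = K])
    fix x y :: ell2 and r :: real and a :: complex
    show "T (x + y) = T x + T y" "T (r *\<^sub>R x) = r *\<^sub>R T x"
      by (rule eqI, simp add: inner_add_right flip: adj)+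
    show "T (a *\<^sub>C x) = a *\<^sub>C T x"
    proof (rule eqI)
      fix z
      have "inner z (T (a *\<^sub>C x)) = inner (S (cnj a *\<^sub>C z)) x"
        using inner_scaleC_left[of "cnj a" "S z" x] by (simp add: bounded_op_scaleC[OF S] flip: adj)
      then show "inner z (T (a *\<^sub>C x)) = inner z (a *\<^sub>C T x)"
        using inner_scaleC_left[of "cnj a" z "T x"] by (simp add: adj)
    qed
    have "norm (T x) * norm (T x) \<le> norm (S (T x)) * norm x"
      using norm_cauchy_schwarz[of "S (T x)" x] by (simp add: adj flip: power2_norm_eq_inner power2_eq_square)
    also have "\<dots> \<le> norm (T x) * K * norm x"
      by (intro mult_right_mono K(2)) simp
    finally have "norm (T x) * norm (T x) \<le> norm (T x) * (norm x * K)" by (simp add: mult_ac)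
    then show "norm (T x) \<le> norm x * K"
      using K(1) by (cases "T x = 0") (simp_all del: norm_le_zero_iff)
  qed
  then show ?thesis using S adj by (simp add: adjoint_pair_def)
qed

lemma adjoint_pair_comp:
  "adjoint_pair S S' \<Longrightarrow> adjoint_pair T T' \<Longrightarrow> adjoint_pair (\<lambda>x. S (T x)) (\<lambda>x. T' (S' x))"
  by (simp add: adjoint_pair_def bounded_op_comp)

lemma adjoint_pair_plus:
  "adjoint_pair S S' \<Longrightarrow> adjoint_pair T T' \<Longrightarrow> adjoint_pair (\<lambda>x. S x + T x) (\<lambda>x. S' x + T' x)"
  by (simp add: adjoint_pair_def bounded_op_plus inner_add_left inner_add_right)

lemma adjoint_pair_scaleC: "adjoint_pair S S' \<Longrightarrow> adjoint_pair (\<lambda>x. a *\<^sub>C S x) (\<lambda>x. cnj a *\<^sub>C S' x)"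
  by (simp add: adjoint_pair_def bounded_op_scaleC_op inner_scaleC_left bounded_op_scaleC)

lemma selfadjoint_adjoint_comp: "adjoint_pair X Y \<Longrightarrow> selfadjoint (Y \<circ> X)"
  using adjoint_pair_comp[OF adjoint_pair_sym, of X Y X Y] by (simp add: o_def)

lemma adjoint_pair_inner_sq: "adjoint_pair S T \<Longrightarrow> inner (T (S x)) x = (norm (S x))\<^sup>2"
  using adjoint_pairD(3)[OF adjoint_pair_sym, of S T "S x" x] by (simp add: power2_norm_eq_inner)

text \<open>An operator and its adjoint have the same norm:
  \<open>\<parallel>S x\<parallel>\<^sup>4 = \<langle>T S x, x\<rangle>\<^sup>2 \<le> \<parallel>T S x\<parallel>\<^sup>2 \<parallel>x\<parallel>\<^sup>2 \<le> K \<parallel>S x\<parallel>\<^sup>2 \<parallel>x\<parallel>\<^sup>2\<close>.\<close>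
lemma norm_sq_adjoint_le:
  assumes "adjoint_pair S T" and le: "\<And>y. (norm (T y))\<^sup>2 \<le> K * (norm y)\<^sup>2"
  shows "(norm (S x))\<^sup>2 \<le> K * (norm x)\<^sup>2"
proof (cases "S x = 0")
  case True
  have "0 \<le> K * (norm x)\<^sup>2" using le[of x] by (rule order_trans[rotated]) simp
  with True show ?thesis by simp
next
  case False
  have "(norm (S x))\<^sup>2 \<le> norm (T (S x)) * norm x"
    using norm_cauchy_schwarz[of "T (S x)" x] by (simp add: adjoint_pair_inner_sq[OF assms(1)])
  then have "((norm (S x))\<^sup>2)\<^sup>2 \<le> (norm (T (S x)))\<^sup>2 * (norm x)\<^sup>2"
    unfolding power_mult_distrib[symmetric] by (rule power_mono) simp
  also have "\<dots> \<le> (K * (norm (S x))\<^sup>2) * (norm x)\<^sup>2"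
    by (rule mult_right_mono[OF le]) simp
  finally have "(norm (S x))\<^sup>2 * (norm (S x))\<^sup>2 \<le> (norm (S x))\<^sup>2 * (K * (norm x)\<^sup>2)"
    by (simp add: power2_eq_square mult_ac)
  then show ?thesis
    by (rule mult_left_le_imp_le) (use False in simp)
qed

lemma selfadjoint_poly_op:
  assumes "selfadjoint T"
  shows "selfadjoint (poly_op p T)"
proof -
  have "inner ((T ^^ n) x) y = inner x ((T ^^ n) y)" for n x y
  proof (induction n arbitrary: y)
    case (Suc n)
    have "inner ((T ^^ Suc n) x) y = inner ((T ^^ n) x) (T y)"
      using adjoint_pairD(3)[OF assms] by simp
    also have "\<dots> = inner x ((T ^^ n) (T y))" by (rule Suc)
    also have "(T ^^ n) (T y) = (T ^^ Suc n) y" by (metis comp_apply funpow_Suc_right)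
    finally show ?case .
  qed simp
  then show ?thesis
    using bounded_op_poly_op[OF adjoint_pairD(1)[OF assms]]
    by (simp add: adjoint_pair_def poly_op_def inner_sum_left inner_sum_right)
qed


section \<open>The real spectrum\<close>

definition bounded_below :: "(ell2 \<Rightarrow> ell2) \<Rightarrow> bool" where
  "bounded_below T \<longleftrightarrow> (\<exists>m>0. \<forall>x. m * norm x \<le> norm (T x))"

lemma not_in_spectrum_iff:
  "z \<notin> spectrum T \<longleftrightarrow> (\<exists>S. bounded_op S \<and> (\<forall>x. S (T x - z *\<^sub>C x) = x) \<and>
                                          (\<forall>x. T (S x) - z *\<^sub>C S x = x))"
  by (simp add: spectrum_def)

lemma bounded_below_if_not_in_spectrum:
  assumes "z \<notin> spectrum T"
  shows "bounded_below (\<lambda>x. T x - z *\<^sub>C x)"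
proof -
  obtain S where S: "bounded_op S" "\<And>x. S (T x - z *\<^sub>C x) = x"
    using assms by (auto simp: not_in_spectrum_iff)
  obtain K where K: "K > 0" "\<And>x. norm (S x) \<le> norm x * K"
    using bounded_linear.pos_bounded[OF bounded_op_bounded_linear[OF S(1)]] by blast
  have "(1 / K) * norm x \<le> norm (T x - z *\<^sub>C x)" for x
    using K(2)[of "T x - z *\<^sub>C x"] K(1) by (simp add: S(2) field_simps)
  then show ?thesis
    unfolding bounded_below_def using K(1) by (intro exI[of _ "1 / K"]) simp
qed

text \<open>To solve \<open>S x = y\<close>, iterate \<open>x \<mapsto> x - t (S x - y)\<close>. With \<open>\<parallel>S\<parallel> \<le> K\<close> the Lipschitz constant of
  this map is at most the square root of \<open>1 - 2 t m + t\<^sup>2 K\<^sup>2\<close>, which is smallest, and less than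
  \<open>1\<close>, for \<open>t = m / K\<^sup>2\<close>.\<close>
lemma lax_milgram:
  assumes S: "bounded_op S" and m: "m > 0" "\<And>x. m * (norm x)\<^sup>2 \<le> inner (S x) x"
  shows "\<exists>R. bounded_op R \<and> (\<forall>x. R (S x) = x) \<and> (\<forall>x. S (R x) = x)"
proof -
  have below: "m * norm x \<le> norm (S x)" for x
  proof (cases "x = 0")
    case False
    have "m * norm x * norm x \<le> norm (S x) * norm x"
      using m(2)[of x] norm_cauchy_schwarz[of "S x" x] by (simp add: power2_eq_square mult.assoc)
    then show ?thesis using False by simp
  qed (simp add: bounded_op_zero[OF S])
  obtain K0 where K0: "K0 > 0" "\<And>x. norm (S x) \<le> norm x * K0"
    using bounded_linear.pos_bounded[OF bounded_op_bounded_linear[OF S]] by blast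
  \<comment> \<open>The maximum ensures \<open>m\<^sup>2 / K\<^sup>2 \<le> 1\<close>, so that the square root in \<open>r\<close> is real.\<close>
  define K where "K = max K0 m"
  have K: "norm (S x) \<le> K * norm x" for x
    using K0(2)[of x] mult_left_mono[of K0 K "norm x"] by (simp add: K_def mult.commute)
  have Kpos: "K > 0" "m \<le> K" using m(1) by (auto simp: K_def)
  define t where "t = m / K\<^sup>2"
  define r where "r = sqrt (1 - m\<^sup>2 / K\<^sup>2)"
  have mK: "m\<^sup>2 / K\<^sup>2 \<le> 1" "0 < m\<^sup>2 / K\<^sup>2"
    using Kpos m(1) by (auto simp: power_mono)
  have r: "0 \<le> r" "r < 1" using mK by (auto simp: r_def)
  have contr: "norm (x - t *\<^sub>R S x) \<le> r * norm x" for x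
  proof (rule power2_le_imp_le)
    have "(norm (x - t *\<^sub>R S x))\<^sup>2 = (norm x)\<^sup>2 - 2 * t * inner (S x) x + t\<^sup>2 * (norm (S x))\<^sup>2"
      by (simp only: power2_norm_eq_inner)
         (simp add: inner_diff_left inner_diff_right inner_commute power2_eq_square algebra_simps)
    also have "\<dots> \<le> (norm x)\<^sup>2 - 2 * t * (m * (norm x)\<^sup>2) + t\<^sup>2 * (K * norm x)\<^sup>2"
      using m Kpos by (intro add_mono diff_mono mult_left_mono power_mono K) (auto simp: t_def)
    also have "\<dots> = (1 - m\<^sup>2 / K\<^sup>2) * (norm x)\<^sup>2"
      using Kpos(1) by (simp add: t_def field_simps power2_eq_square)
    also have "\<dots> = (r * norm x)\<^sup>2"
      using mK by (simp add: r_def power_mult_distrib)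
    finally show "(norm (x - t *\<^sub>R S x))\<^sup>2 \<le> (r * norm x)\<^sup>2" .
  qed (use r in simp)
  have tpos: "t > 0" using m Kpos by (simp add: t_def)
  have "\<exists>x. S x = y" for y
  proof -
    have "\<exists>!x. x - t *\<^sub>R S x + t *\<^sub>R y = x"
    proof (rule banach_fix_type[OF r], intro allI)
      fix x x'
      show "dist (x - t *\<^sub>R S x + t *\<^sub>R y) (x' - t *\<^sub>R S x' + t *\<^sub>R y) \<le> r * dist x x'"
        using contr[of "x - x'"] by (simp add: dist_norm bounded_op_diff[OF S] algebra_simps)
    qed
    then obtain x where "x - t *\<^sub>R S x + t *\<^sub>R y = x" by blast
    then have "t *\<^sub>R (y - S x) = 0" by (simp add: algebra_simps)
    then show ?thesis using tpos by auto
  qed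
  then obtain R where R: "\<And>y. S (R y) = y" by metis
  have inj: "x = y" if "S x = S y" for x y
    using below[of "x - y"] that m(1) by (simp add: bounded_op_diff[OF S] mult_le_0_iff)
  have "bounded_op R"
    unfolding bounded_op_def
  proof (intro conjI allI bounded_linear_intro[where K = "1 / m"])
    show "norm (R x) \<le> norm x * (1 / m)" for x
      using below[of "R x"] m(1) by (simp add: R field_simps)
  next show "R (x + y) = R x + R y" for x y by (rule inj) (simp add: R bounded_op_add[OF S])
  next show "R (r *\<^sub>R x) = r *\<^sub>R R x" for r x by (rule inj) (simp add: R bounded_op_scaleR[OF S])
  next show "R (r *\<^sub>C x) = r *\<^sub>C R x" for r x by (rule inj) (simp add: R bounded_op_scaleC[OF S])
  qed
  moreover have "R (S x) = x" for x by (rule inj) (rule R)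
  ultimately show ?thesis using R by (intro exI[of _ R]) simp
qed

abbreviation real_spectrum :: "(ell2 \<Rightarrow> ell2) \<Rightarrow> real set" where
  "real_spectrum T \<equiv> {s. complex_of_real s \<in> spectrum T}"

lemma not_in_real_spectrum_iff:
  "s \<notin> real_spectrum T \<longleftrightarrow> (\<exists>S. bounded_op S \<and> (\<forall>x. S (T x - s *\<^sub>R x) = x) \<and>
                                          (\<forall>x. T (S x) - s *\<^sub>R S x = x))"
  by (simp add: spectrum_def scaleC_of_real)

text \<open>A lower bound of the quadratic form is a lower bound of the real spectrum: below it
  \<open>T - s\<close> is coercive, hence invertible.\<close>
lemma real_spectrum_ge:
  assumes T: "bounded_op T" and m: "\<And>x. m * (norm x)\<^sup>2 \<le> inner (T x) x" and s: "s \<in> real_spectrum T"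
  shows "m \<le> s"
proof (rule ccontr)
  assume "\<not> m \<le> s"
  have "bounded_op (\<lambda>x. T x - s *\<^sub>R x)"
    by (intro bounded_op_intros T)
  moreover have "(m - s) * (norm x)\<^sup>2 \<le> inner (T x - s *\<^sub>R x) x" for x
    using m[of x] by (simp add: inner_diff_left power2_norm_eq_inner algebra_simps)
  ultimately show False
    using lax_milgram[of "\<lambda>x. T x - s *\<^sub>R x" "m - s"] \<open>\<not> m \<le> s\<close> s not_in_real_spectrum_iff[of s T]
    by auto
qed

lemma real_spectrum_le:
  assumes T: "bounded_op T" and M: "\<And>x. inner (T x) x \<le> M * (norm x)\<^sup>2" and s: "s \<in> real_spectrum T"
  shows "s \<le> M"
proof (rule ccontr)
  assume less: "\<not> s \<le> M"
  have "bounded_op (\<lambda>x. s *\<^sub>R x - T x)"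
    by (intro bounded_op_intros T)
  moreover have "(s - M) * (norm x)\<^sup>2 \<le> inner (s *\<^sub>R x - T x) x" for x
    using M[of x] by (simp add: inner_diff_left power2_norm_eq_inner algebra_simps)
  ultimately obtain R where R: "bounded_op R" "\<And>x. R (s *\<^sub>R x - T x) = x" "\<And>x. s *\<^sub>R R x - T (R x) = x"
    using lax_milgram[of "\<lambda>x. s *\<^sub>R x - T x" "s - M"] less by auto
  have "R (T x - s *\<^sub>R x) = - x" for x
    using R(2)[of x] bounded_op_scaleR[OF R(1), of "-1" "s *\<^sub>R x - T x"] by simp
  then have left: "(-1) *\<^sub>R R (T x - s *\<^sub>R x) = x" for x
    by simp
  have right: "T ((-1) *\<^sub>R R x) - s *\<^sub>R (-1) *\<^sub>R R x = x" for x
    using R(3)[of x] by (simp only: bounded_op_scaleR[OF T]) simp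
  have "s \<notin> real_spectrum T"
    unfolding not_in_real_spectrum_iff
    by (intro exI[of _ "\<lambda>x. (-1) *\<^sub>R R x"] conjI allI bounded_op_scaleR_op R(1) left right)
  then show False using s by simp
qed

lemma real_spectrum_bounded:
  assumes T: "bounded_op T"
  shows "\<exists>M. real_spectrum T \<subseteq> {- M..M}"
proof -
  have "\<bar>inner (T x) x\<bar> \<le> onorm T * (norm x)\<^sup>2" for x
  proof -
    have "\<bar>inner (T x) x\<bar> \<le> norm (T x) * norm x" by (rule Cauchy_Schwarz_ineq2)
    also have "\<dots> \<le> onorm T * norm x * norm x"
      by (intro mult_right_mono onorm bounded_op_bounded_linear T) simp
    finally show ?thesis by (simp add: power2_eq_square mult.assoc)
  qed
  then show ?thesis
    using real_spectrum_ge[OF T, of "- onorm T"] real_spectrum_le[OF T, of "onorm T"]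
    by (intro exI[of _ "onorm T"]) (auto simp: abs_le_iff minus_le_iff)
qed

lemma eigenvalue_in_spectrum:
  assumes "T x = s *\<^sub>R x" "x \<noteq> 0"
  shows "s \<in> real_spectrum T"
proof (rule ccontr)
  assume "s \<notin> real_spectrum T"
  then obtain S where S: "bounded_op S" "\<And>x. S (T x - s *\<^sub>R x) = x"
    unfolding not_in_real_spectrum_iff by blast
  show False using S(2)[of x] assms bounded_op_zero[OF S(1)] by simp
qed

text \<open>If \<open>R\<close> inverts \<open>X Y - s\<close>, then \<open>(Y R X - 1) / s\<close> inverts \<open>Y X - s\<close>.\<close>
lemma real_spectrum_comp_commute:
  assumes X: "bounded_op X" and Y: "bounded_op Y" and s: "s \<in> real_spectrum (Y \<circ> X)" "s \<noteq> 0"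
  shows "s \<in> real_spectrum (X \<circ> Y)"
proof (rule ccontr)
  assume "s \<notin> real_spectrum (X \<circ> Y)"
  then obtain R where R: "bounded_op R" "\<And>x. R (X (Y x) - s *\<^sub>R x) = x"
      "\<And>x. X (Y (R x)) - s *\<^sub>R R x = x"
    unfolding not_in_real_spectrum_iff comp_apply by blast
  note lin = bounded_op_diff bounded_op_scaleR
  define Q where "Q x = (1 / s) *\<^sub>R (Y (R (X x)) - x)" for x
  have "bounded_op Q"
    unfolding Q_def by (intro bounded_op_intros bounded_op_comp[OF Y bounded_op_comp[OF R(1) X]])
  moreover have "Q (Y (X x) - s *\<^sub>R x) = x" for x
    using R(2)[of "X x"] s(2) by (simp add: Q_def lin[OF X] scaleR_diff_right)
  moreover have "Y (X (Q x)) - s *\<^sub>R Q x = x" for x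
  proof -
    have "X (Y (R (X x))) = X x + s *\<^sub>R R (X x)"
      using R(3)[of "X x"] by (simp add: algebra_simps)
    then have "Y (X (Q x)) = Y (R (X x))"
      using s(2) by (simp add: Q_def lin[OF X] lin[OF Y])
    then show ?thesis using s(2) by (simp add: Q_def)
  qed
  ultimately have "s \<notin> real_spectrum (Y \<circ> X)"
    unfolding not_in_real_spectrum_iff comp_apply by blast
  then show False using s(1) by simp
qed

section \<open>Polynomials of an operator\<close>

text \<open>Complex coefficients are used for one purpose: a polynomial then splits into linear factors.\<close>
definition complex_poly_op :: "complex poly \<Rightarrow> (ell2 \<Rightarrow> ell2) \<Rightarrow> ell2 \<Rightarrow> ell2" where
  "complex_poly_op p T x = (\<Sum>i\<le>degree p. coeff p i *\<^sub>C (T ^^ i) x)"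

lemma poly_op_eq_sum:
  "degree p \<le> N \<Longrightarrow> poly_op p T x = (\<Sum>i\<le>N. coeff p i *\<^sub>R (T ^^ i) x)"
  unfolding poly_op_def by (rule sum.mono_neutral_left) (auto simp: coeff_eq_0)

lemma complex_poly_op_eq_sum:
  "degree p \<le> N \<Longrightarrow> complex_poly_op p T x = (\<Sum>i\<le>N. coeff p i *\<^sub>C (T ^^ i) x)"
  unfolding complex_poly_op_def by (rule sum.mono_neutral_left) (auto simp: coeff_eq_0)

lemma poly_op_add: "poly_op (p + r) T x = poly_op p T x + poly_op r T x"
  by (simp add: poly_op_eq_sum[where N = "max (degree p) (degree r)"] degree_add_le
      scaleR_add_left sum.distrib)

lemma poly_op_smult: "poly_op (smult a p) T x = a *\<^sub>R poly_op p T x"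
  by (simp add: poly_op_eq_sum[where N = "degree p"] degree_smult_le scaleR_sum_right)

lemma poly_op_diff: "poly_op (p - r) T x = poly_op p T x - poly_op r T x"
  using poly_op_add[of p "smult (-1) r" T x] poly_op_smult[of "-1" r T x] by simp

lemma poly_op_0 [simp]: "poly_op 0 T x = 0"
  by (simp add: poly_op_def)

lemma poly_op_pCons:
  assumes "bounded_op T"
  shows "poly_op (pCons a p) T x = a *\<^sub>R x + T (poly_op p T x)"
proof -
  have "poly_op (pCons a p) T x = (\<Sum>i\<le>Suc (degree p). coeff (pCons a p) i *\<^sub>R (T ^^ i) x)"
    by (rule poly_op_eq_sum) (simp add: degree_pCons_le)
  also have "\<dots> = a *\<^sub>R x + (\<Sum>i\<le>degree p. T (coeff p i *\<^sub>R (T ^^ i) x))"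
    by (simp add: sum.atMost_Suc_shift bounded_op_scaleR[OF assms] del: sum.atMost_Suc)
  also have "(\<Sum>i\<le>degree p. T (coeff p i *\<^sub>R (T ^^ i) x)) = T (poly_op p T x)"
    unfolding poly_op_def
    by (rule linear_sum[symmetric, OF bounded_linear.linear[OF bounded_op_bounded_linear[OF assms]]])
  finally show ?thesis .
qed

lemma poly_op_mult:
  assumes "bounded_op T"
  shows "poly_op (p * r) T x = poly_op p T (poly_op r T x)"
  by (induction p)
     (simp_all add: poly_op_pCons[OF assms] poly_op_add poly_op_smult bounded_op_add[OF assms]
       bounded_op_zero[OF assms])

lemma complex_poly_op_linear_factor:
  assumes "bounded_op T"
  shows "complex_poly_op ([:- z, 1:] * p) T x
    = T (complex_poly_op p T x) - z *\<^sub>C complex_poly_op p T x"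
proof -
  define N where "N = Suc (degree p)"
  have deg: "degree ([:- z, 1:] * p) \<le> N"
    using degree_mult_le[of "[:- z, 1:]" p] by (simp add: N_def)
  have shift: "T (complex_poly_op p T x) = (\<Sum>i\<le>N. coeff (pCons 0 p) i *\<^sub>C (T ^^ i) x)"
  proof -
    have "(\<Sum>i\<le>N. coeff (pCons 0 p) i *\<^sub>C (T ^^ i) x) = (\<Sum>i\<le>degree p. T (coeff p i *\<^sub>C (T ^^ i) x))"
      by (simp add: N_def sum.atMost_Suc_shift bounded_op_scaleC[OF assms] del: sum.atMost_Suc)
    also have "\<dots> = T (complex_poly_op p T x)"
      unfolding complex_poly_op_def
      by (rule linear_sum[symmetric, OF bounded_linear.linear[OF bounded_op_bounded_linear[OF assms]]])
    finally show ?thesis by simp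
  qed
  have "complex_poly_op ([:- z, 1:] * p) T x
      = (\<Sum>i\<le>N. coeff (pCons 0 p) i *\<^sub>C (T ^^ i) x - z *\<^sub>C coeff p i *\<^sub>C (T ^^ i) x)"
    by (subst complex_poly_op_eq_sum[OF deg]) (auto intro!: sum.cong ell2_eqI simp: algebra_simps)
  also have "\<dots> = T (complex_poly_op p T x) - z *\<^sub>C (\<Sum>i\<le>N. coeff p i *\<^sub>C (T ^^ i) x)"
    by (simp add: sum_subtractf shift ell2.scale_sum_right)
  finally show ?thesis
    by (simp add: N_def complex_poly_op_eq_sum[where N = "Suc (degree p)"])
qed

lemma complex_poly_op_of_real: "complex_poly_op (map_poly complex_of_real p) T = poly_op p T"
  by (simp add: fun_eq_iff complex_poly_op_def poly_op_def degree_map_poly coeff_map_poly scaleC_of_real)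

lemma poly_map_poly_of_real: "poly (map_poly complex_of_real p) (of_real s) = of_real (poly p s)"
  by (simp add: poly_altdef degree_map_poly coeff_map_poly)

lemma poly_op_eigenvector:
  assumes T: "bounded_op T" and "T x = s *\<^sub>R x"
  shows "poly_op p T x = poly p s *\<^sub>R x"
  by (induction p) (simp_all add: poly_op_pCons[OF T] bounded_op_scaleR[OF T] assms(2) algebra_simps)


section \<open>The norm of a polynomial of a self-adjoint operator\<close>

lemma complex_poly_op_bounded_below:
  assumes T: "bounded_op T" and "p \<noteq> 0"
    and "\<And>z. poly p z = 0 \<Longrightarrow> bounded_below (\<lambda>x. T x - z *\<^sub>C x)"
  shows "bounded_below (complex_poly_op p T)"
  using assms(2,3)
proof (induction "degree p" arbitrary: p)
  case 0
  then obtain a where a: "p = [:a:]" "a \<noteq> 0"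
    by (metis degree_eq_zeroE pCons_0_0)
  then show ?case
    unfolding bounded_below_def
    by (intro exI[of _ "cmod a"]) (simp add: complex_poly_op_def norm_scaleC)
next
  case (Suc n)
  then have "\<not> constant (poly p)"
    by (simp add: constant_degree)
  then obtain z where z: "poly p z = 0"
    using fundamental_theorem_of_algebra by blast
  then obtain r where r: "p = [:- z, 1:] * r"
    by (metis dvdE poly_eq_0_iff_dvd)
  with Suc.prems have "r \<noteq> 0" by auto
  then have "degree p = Suc (degree r)"
    unfolding r by (subst degree_mult_eq) auto
  then have "bounded_below (complex_poly_op r T)"
    using Suc.hyps \<open>r \<noteq> 0\<close> Suc.prems(2) by (auto simp: r)
  then obtain m where m: "m > 0" "\<And>x. m * norm x \<le> norm (complex_poly_op r T x)"
    by (auto simp: bounded_below_def)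
  obtain k where k: "k > 0" "\<And>x. k * norm x \<le> norm (T x - z *\<^sub>C x)"
    using Suc.prems(2)[OF z] by (auto simp: bounded_below_def)
  have "k * m * norm x \<le> norm (complex_poly_op p T x)" for x
  proof -
    have "k * (m * norm x) \<le> k * norm (complex_poly_op r T x)"
      using m k by simp
    also have "\<dots> \<le> norm (complex_poly_op p T x)"
      unfolding r complex_poly_op_linear_factor[OF T] by (rule k)
    finally show ?thesis by (simp add: mult.assoc)
  qed
  then show ?case
    unfolding bounded_below_def using m k by (intro exI[of _ "k * m"]) simp
qed

text \<open>For \<open>z = a + \<i> b\<close> the vectors \<open>(T - a) x\<close> and \<open>\<i> b x\<close> are orthogonal for the real inner product,
  so \<open>\<parallel>(T - z) x\<parallel> \<ge> \<bar>b\<bar> \<parallel>x\<parallel>\<close> by Pythagoras.\<close>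
lemma selfadjoint_bounded_below_nonreal:
  assumes T: "selfadjoint T" and "Im z \<noteq> 0"
  shows "bounded_below (\<lambda>x. T x - z *\<^sub>C x)"
proof -
  note op = adjoint_pairD(1)[OF T]
  have "\<bar>Im z\<bar> * norm x \<le> norm (T x - z *\<^sub>C x)" for x
  proof (rule power2_le_imp_le)
    define y where "y = T x - Re z *\<^sub>R x"
    have skew: "inner (\<i> *\<^sub>C u) u = 0" for u
      using inner_scaleC_left[of \<i> u u] by (simp add: inner_commute)
    have "inner (T x) (\<i> *\<^sub>C x) = inner x (\<i> *\<^sub>C T x)"
      using adjoint_pairD(3)[OF T] bounded_op_scaleC[OF op] by simp
    also have "\<dots> = - inner (T x) (\<i> *\<^sub>C x)"
      using inner_scaleC_left[of \<i> x "T x"] inner_commute[of "\<i> *\<^sub>C x" "T x"] by simp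
    finally have "inner y (\<i> *\<^sub>C x) = 0"
      using skew[of x] inner_commute[of x "\<i> *\<^sub>C x"] by (simp add: y_def inner_diff_left)
    moreover have "T x - z *\<^sub>C x = y - Im z *\<^sub>R \<i> *\<^sub>C x"
      by (rule ell2_eqI) (simp add: y_def scaleR_conv_of_real complex_eq_iff algebra_simps)
    ultimately have "(norm (T x - z *\<^sub>C x))\<^sup>2 = (norm y)\<^sup>2 + (norm (Im z *\<^sub>R \<i> *\<^sub>C x))\<^sup>2"
      by (simp only: power2_norm_eq_inner)
        (simp add: inner_diff_left inner_diff_right inner_commute)
    then show "(\<bar>Im z\<bar> * norm x)\<^sup>2 \<le> (norm (T x - z *\<^sub>C x))\<^sup>2"
      by (simp add: norm_scaleC power_mult_distrib)
  qed simp
  then show ?thesis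
    unfolding bounded_below_def using assms(2) by (intro exI[of _ "\<bar>Im z\<bar>"]) simp
qed

text \<open>With \<open>N = \<parallel>S\<parallel>\<close>, expanding the square gives
  \<open>\<parallel>S\<^sup>2 x - N\<^sup>2 x\<parallel>\<^sup>2 \<le> N\<^sup>2 (N\<^sup>2 \<parallel>x\<parallel>\<^sup>2 - \<parallel>S x\<parallel>\<^sup>2)\<close>. On unit vectors with \<open>\<parallel>S x\<parallel>\<close> close to \<open>N\<close> the
  right-hand side is small; a lower bound \<open>m\<close> on the left would push \<open>\<parallel>S\<parallel>\<close> strictly below \<open>N\<close>.\<close>
lemma selfadjoint_square_not_bounded_below:
  assumes S: "selfadjoint S"
  shows "\<not> bounded_below (\<lambda>x. S (S x) - (onorm S)\<^sup>2 *\<^sub>R x)"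
proof
  define N where "N = onorm S"
  note op = adjoint_pairD(1)[OF S]
  have le: "norm (S x) \<le> N * norm x" for x
    unfolding N_def by (rule onorm[OF bounded_op_bounded_linear[OF op]])
  have N0: "0 \<le> N"
    unfolding N_def by (rule onorm_pos_le[OF bounded_op_bounded_linear[OF op]])
  assume "bounded_below (\<lambda>x. S (S x) - (onorm S)\<^sup>2 *\<^sub>R x)"
  then obtain m where m: "m > 0" "\<And>x. m * norm x \<le> norm (S (S x) - N\<^sup>2 *\<^sub>R x)"
    by (auto simp: bounded_below_def N_def)
  have key: "m\<^sup>2 * (norm x)\<^sup>2 + N\<^sup>2 * (norm (S x))\<^sup>2 \<le> N ^ 4 * (norm x)\<^sup>2" for x
  proof -
    have "m\<^sup>2 * (norm x)\<^sup>2 \<le> (norm (S (S x) - N\<^sup>2 *\<^sub>R x))\<^sup>2"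
      using power_mono[OF m(2)[of x], of 2] m(1) by (simp add: power_mult_distrib)
    also have "\<dots> = (norm (S (S x)))\<^sup>2 - 2 * N\<^sup>2 * inner (S (S x)) x + N ^ 4 * (norm x)\<^sup>2"
      by (simp only: power2_norm_eq_inner)
         (simp add: inner_diff_left inner_diff_right inner_commute power4_eq_xxxx
           power2_eq_square algebra_simps)
    also have "inner (S (S x)) x = (norm (S x))\<^sup>2"
      by (simp add: adjoint_pairD(3)[OF S] power2_norm_eq_inner)
    also have "(norm (S (S x)))\<^sup>2 \<le> N\<^sup>2 * (norm (S x))\<^sup>2"
      using power_mono[OF le[of "S x"], of 2] by (simp add: power_mult_distrib)
    finally show ?thesis by (simp add: algebra_simps)
  qed
  have "basis_vec 0 \<noteq> 0"
    by (metis coord_simps(1,7) of_bool_eq_1_iff zero_neq_one)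
  have "N > 0"
  proof (rule ccontr)
    assume "\<not> N > 0"
    with N0 have "N = 0" by simp
    with key[of "basis_vec 0"] m(1) \<open>basis_vec 0 \<noteq> 0\<close> show False
      by (simp add: mult_le_0_iff power2_eq_square)
  qed
  define r where "r = sqrt (max 0 (N\<^sup>2 - m\<^sup>2 / N\<^sup>2))"
  have "norm (S x) \<le> r * norm x" for x
  proof (rule power2_le_imp_le)
    have "(norm (S x))\<^sup>2 \<le> (N\<^sup>2 - m\<^sup>2 / N\<^sup>2) * (norm x)\<^sup>2"
      using key[of x] \<open>N > 0\<close> by (simp add: field_simps power4_eq_xxxx power2_eq_square)
    also have "\<dots> \<le> (r * norm x)\<^sup>2"
      by (simp add: r_def power_mult_distrib mult_right_mono)
    finally show "(norm (S x))\<^sup>2 \<le> (r * norm x)\<^sup>2" .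
  qed (simp add: r_def)
  then have "N \<le> r"
    unfolding N_def by (rule onorm_bound[rotated]) (simp add: r_def)
  moreover have "r < sqrt (N\<^sup>2)"
    unfolding r_def using \<open>N > 0\<close> m(1) by (intro real_sqrt_less_mono) simp
  ultimately show False
    using \<open>N > 0\<close> by simp
qed

text \<open>If no root of \<open>p\<close> lay in the real spectrum, all linear factors of \<open>p(T)\<close> would be bounded below: those
  of non-real roots because \<open>T\<close> is self-adjoint, those of real roots because they are invertible.\<close>
lemma root_in_real_spectrum:
  assumes T: "selfadjoint T" and "p \<noteq> 0" and "\<not> bounded_below (poly_op p T)"
  shows "\<exists>s \<in> real_spectrum T. poly p s = 0"
proof (rule ccontr)
  assume none: "\<not> (\<exists>s \<in> real_spectrum T. poly p s = 0)"
  have "bounded_below (\<lambda>x. T x - z *\<^sub>C x)" if z: "poly (map_poly complex_of_real p) z = 0" for z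
  proof (cases "Im z = 0")
    case True
    then have "z = of_real (Re z)" by (simp add: complex_eq_iff)
    moreover from this have "poly p (Re z) = 0"
      using z by (metis of_real_eq_0_iff poly_map_poly_of_real)
    ultimately show ?thesis
      using none bounded_below_if_not_in_spectrum[of z T] by force
  qed (rule selfadjoint_bounded_below_nonreal[OF T])
  then have "bounded_below (complex_poly_op (map_poly complex_of_real p) T)"
    using assms(2) by (intro complex_poly_op_bounded_below adjoint_pairD(1)[OF T]) (auto simp: map_poly_eq_0_iff)
  then show False
    using assms(3) by (simp add: complex_poly_op_of_real)
qed

text \<open>Applied to \<open>s\<^sup>2 - \<parallel>T\<parallel>\<^sup>2\<close>, the previous lemma shows that \<open>\<parallel>T\<parallel>\<close> or \<open>- \<parallel>T\<parallel>\<close> is in the spectrum.\<close>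
lemma real_spectrum_nonempty:
  assumes T: "selfadjoint T"
  shows "real_spectrum T \<noteq> {}"
proof -
  define p where "p = [:- ((onorm T)\<^sup>2), 0, 1:]"
  have "poly_op p T x = T (T x) - (onorm T)\<^sup>2 *\<^sub>R x" for x
    using adjoint_pairD(1)[OF T] by (simp add: p_def poly_op_pCons bounded_op_zero)
  then have "\<not> bounded_below (poly_op p T)"
    using selfadjoint_square_not_bounded_below[OF T] by presburger
  then show ?thesis
    using root_in_real_spectrum[OF T, of p] by (auto simp: p_def)
qed

text \<open>If \<open>N = \<parallel>p(T)\<parallel>\<close> exceeded \<open>B\<close>, the
  polynomial \<open>p\<^sup>2 - N\<^sup>2\<close> would have no zero on the spectrum, whereas \<open>p(T)\<^sup>2 - N\<^sup>2\<close> is not bounded below.\<close>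
lemma norm_poly_op_le:
  assumes T: "selfadjoint T" and B: "\<And>s. s \<in> real_spectrum T \<Longrightarrow> \<bar>poly p s\<bar> \<le> B"
  shows "onorm (poly_op p T) \<le> B"
proof (rule ccontr)
  define N where "N = onorm (poly_op p T)"
  define r where "r = p * p - [:N\<^sup>2:]"
  note op = adjoint_pairD(1)[OF T]
  assume "\<not> onorm (poly_op p T) \<le> B"
  then have N: "B < N" by (simp add: N_def)
  have no_root: "poly r s \<noteq> 0" if "s \<in> real_spectrum T" for s
  proof
    assume "poly r s = 0"
    then have "(poly p s)\<^sup>2 = N\<^sup>2" by (simp add: r_def power2_eq_square)
    then have "\<bar>poly p s\<bar> = \<bar>N\<bar>" by (simp add: power2_eq_iff abs_eq_iff)
    then show False using B[OF that] N by simp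
  qed
  have "poly_op r T x = poly_op p T (poly_op p T x) - N\<^sup>2 *\<^sub>R x" for x
    by (simp add: r_def poly_op_diff poly_op_mult[OF op] poly_op_pCons[OF op] bounded_op_zero[OF op])
  then have "\<not> bounded_below (poly_op r T)"
    using selfadjoint_square_not_bounded_below[OF selfadjoint_poly_op[OF T], of p]
    unfolding N_def by presburger
  moreover have "r \<noteq> 0"
    using real_spectrum_nonempty[OF T] no_root by auto
  ultimately show False
    using root_in_real_spectrum[OF T, of r] no_root by blast
qed

section \<open>Functional calculus\<close>

text \<open>The property that characterizes \<^term>\<open>fun_calc f T\<close> in its definition, as a relation. Relations can
  be composed and compared before it is known that they determine the operator.\<close>
definition is_fun_calc :: "(real \<Rightarrow> real) \<Rightarrow> (ell2 \<Rightarrow> ell2) \<Rightarrow> (ell2 \<Rightarrow> ell2) \<Rightarrow> bool" where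
  "is_fun_calc f T S \<longleftrightarrow> bounded_op S \<and>
     (\<exists>p. uniform_limit (real_spectrum T) (\<lambda>n. poly (p n)) f sequentially \<and>
          (\<lambda>n. onorm (\<lambda>x. poly_op (p n) T x - S x)) \<longlonglongrightarrow> 0)"

lemma is_fun_calc_bounded_op: "is_fun_calc f T S \<Longrightarrow> bounded_op S"
  by (simp add: is_fun_calc_def)

text \<open>The argument \<open>y n\<close> varies with \<open>n\<close> so that limits of products of polynomials are covered.\<close>
lemma tendsto_if_onorm_tendsto_0:
  assumes T: "bounded_op T" and S: "bounded_op S"
    and lim: "(\<lambda>n. onorm (\<lambda>x. poly_op (p n) T x - S x)) \<longlonglongrightarrow> 0" and y: "y \<longlonglongrightarrow> x"
  shows "(\<lambda>n. poly_op (p n) T (y n)) \<longlonglongrightarrow> S x"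
proof -
  have "norm (poly_op (p n) T (y n) - S (y n)) \<le> onorm (\<lambda>x. poly_op (p n) T x - S x) * norm (y n)" for n
    by (intro onorm bounded_op_bounded_linear bounded_op_minus bounded_op_poly_op T S)
  moreover have "(\<lambda>n. onorm (\<lambda>x. poly_op (p n) T x - S x) * norm (y n)) \<longlonglongrightarrow> 0"
    using tendsto_mult[OF lim tendsto_norm[OF y]] by simp
  ultimately have "(\<lambda>n. poly_op (p n) T (y n) - S (y n)) \<longlonglongrightarrow> 0"
    by (rule Lim_null_comparison[OF always_eventually, OF allI])
  moreover have "(\<lambda>n. S (y n)) \<longlonglongrightarrow> S x"
    by (rule bounded_linear.tendsto[OF bounded_op_bounded_linear[OF S] y])
  ultimately show ?thesis
    using tendsto_add by fastforce
qed

lemma is_fun_calcE: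
  assumes "bounded_op T" "is_fun_calc f T S"
  obtains p where "uniform_limit (real_spectrum T) (\<lambda>n. poly (p n)) f sequentially"
    and "\<And>y x. y \<longlonglongrightarrow> x \<Longrightarrow> (\<lambda>n. poly_op (p n) T (y n)) \<longlonglongrightarrow> S x"
  using assms unfolding is_fun_calc_def by (auto dest: tendsto_if_onorm_tendsto_0)

lemma poly_op_uniformly_Cauchy:
  assumes T: "selfadjoint T" and e: "e > 0"
    and p: "uniform_limit (real_spectrum T) (\<lambda>n. poly (p n)) f sequentially"
    and r: "uniform_limit (real_spectrum T) (\<lambda>n. poly (r n)) f sequentially"
  shows "\<exists>N. \<forall>m\<ge>N. \<forall>n\<ge>N. \<forall>x. norm (poly_op (p m) T x - poly_op (r n) T x) \<le> e * norm x"
proof -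
  have "\<forall>\<^sub>F n in sequentially. \<forall>s\<in>real_spectrum T. dist (poly (p n) s) (f s) < e / 2"
    "\<forall>\<^sub>F n in sequentially. \<forall>s\<in>real_spectrum T. dist (poly (r n) s) (f s) < e / 2"
    using uniform_limitD[OF p, of "e / 2"] uniform_limitD[OF r, of "e / 2"] e by simp_all
  then obtain N M where N: "\<And>n s. n \<ge> N \<Longrightarrow> s \<in> real_spectrum T \<Longrightarrow> dist (poly (p n) s) (f s) < e / 2"
    and M: "\<And>n s. n \<ge> M \<Longrightarrow> s \<in> real_spectrum T \<Longrightarrow> dist (poly (r n) s) (f s) < e / 2"
    unfolding eventually_sequentially by blast
  have "norm (poly_op (p m) T x - poly_op (r n) T x) \<le> e * norm x"
    if "m \<ge> max N M" "n \<ge> max N M" for m n x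
  proof -
    have "onorm (poly_op (p m - r n) T) \<le> e"
    proof (rule norm_poly_op_le[OF T])
      fix s assume "s \<in> real_spectrum T"
      then show "\<bar>poly (p m - r n) s\<bar> \<le> e"
        using N[of m s] M[of n s] that
            abs_triangle_ineq4[of "poly (p m) s - f s" "poly (r n) s - f s"]
          by (simp add: dist_real_def)
    qed
    moreover have "norm (poly_op (p m - r n) T x) \<le> onorm (poly_op (p m - r n) T) * norm x"
      by (intro onorm bounded_op_bounded_linear bounded_op_poly_op adjoint_pairD(1)[OF T])
    ultimately show ?thesis
      by (metis poly_op_diff mult_right_mono norm_ge_zero order_trans)
  qed
  then show ?thesis by blast
qed

lemma is_fun_calc_unique:
  assumes T: "selfadjoint T" and "is_fun_calc f T S" "is_fun_calc f T S'"
  shows "S = S'"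
proof
  fix x
  obtain p where p: "uniform_limit (real_spectrum T) (\<lambda>n. poly (p n)) f sequentially"
    "\<And>y x. y \<longlonglongrightarrow> x \<Longrightarrow> (\<lambda>n. poly_op (p n) T (y n)) \<longlonglongrightarrow> S x"
    by (rule is_fun_calcE[OF adjoint_pairD(1)[OF T] assms(2)]) blast
  obtain r where r: "uniform_limit (real_spectrum T) (\<lambda>n. poly (r n)) f sequentially"
    "\<And>y x. y \<longlonglongrightarrow> x \<Longrightarrow> (\<lambda>n. poly_op (r n) T (y n)) \<longlonglongrightarrow> S' x"
    by (rule is_fun_calcE[OF adjoint_pairD(1)[OF T] assms(3)]) blast
  have lim: "(\<lambda>n. norm (poly_op (p n) T x - poly_op (r n) T x)) \<longlonglongrightarrow> norm (S x - S' x)"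
    by (intro tendsto_norm tendsto_diff p(2)[OF tendsto_const] r(2)[OF tendsto_const])
  have le: "norm (S x - S' x) \<le> e * norm x" if "e > 0" for e
  proof (rule LIMSEQ_le_const2[OF lim])
    show "\<exists>N. \<forall>n\<ge>N. norm (poly_op (p n) T x - poly_op (r n) T x) \<le> e * norm x"
      using poly_op_uniformly_Cauchy[OF T that p(1) r(1)] by meson
  qed
  have "norm (S x - S' x) \<le> 0 + e" if "e > 0" for e
  proof -
    have "norm x + 1 > 0" by (simp add: add_nonneg_pos)
    then have "e / (norm x + 1) > 0" "e / (norm x + 1) * norm x \<le> e"
      using that by (simp_all add: field_simps)
    with le show ?thesis by (metis add_0 order_trans)
  qed
  then have "norm (S x - S' x) \<le> 0"
    by (rule field_le_epsilon)
  then show "S x = S' x" by simp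
qed

lemma fun_calc_eqI:
  assumes "selfadjoint T" "is_fun_calc f T S"
  shows "fun_calc f T = S"
  unfolding fun_calc_def is_fun_calc_def[symmetric]
  by (rule the_equality) (use assms is_fun_calc_unique in blast)+

text \<open>Uniform convergence on the spectrum makes the polynomials \<open>p\<^sub>n(T)\<close> a Cauchy sequence in operator
  norm, so a pointwise limit is a limit in norm.\<close>
lemma is_fun_calc_if_pointwise:
  assumes T: "selfadjoint T" and S: "bounded_op S"
    and p: "uniform_limit (real_spectrum T) (\<lambda>n. poly (p n)) f sequentially"
    and lim: "\<And>x. (\<lambda>n. poly_op (p n) T x) \<longlonglongrightarrow> S x"
  shows "is_fun_calc f T S"
  unfolding is_fun_calc_def
proof (intro conjI exI[of _ p] S p)
  show "(\<lambda>n. onorm (\<lambda>x. poly_op (p n) T x - S x)) \<longlonglongrightarrow> 0"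
  proof (rule LIMSEQ_I)
    fix e :: real assume e: "e > 0"
    obtain N where N: "\<And>m n x. m \<ge> N \<Longrightarrow> n \<ge> N \<Longrightarrow>
        norm (poly_op (p m) T x - poly_op (p n) T x) \<le> e / 2 * norm x"
      using poly_op_uniformly_Cauchy[OF T _ p p, of "e / 2"] e by auto
    have "norm (onorm (\<lambda>x. poly_op (p n) T x - S x) - 0) < e" if n: "n \<ge> N" for n
    proof -
      have "norm (poly_op (p n) T x - S x) \<le> e / 2 * norm x" for x
      proof (rule LIMSEQ_le_const2)
        show "(\<lambda>m. norm (poly_op (p n) T x - poly_op (p m) T x)) \<longlonglongrightarrow> norm (poly_op (p n) T x - S x)"
          by (intro tendsto_intros lim)
      qed (use N n in blast)
      then have "onorm (\<lambda>x. poly_op (p n) T x - S x) \<le> e / 2"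
        using e by (intro onorm_bound) auto
      moreover have "0 \<le> onorm (\<lambda>x. poly_op (p n) T x - S x)"
        by (intro onorm_pos_le bounded_op_bounded_linear bounded_op_minus bounded_op_poly_op S
            adjoint_pairD(1)[OF T])
      ultimately show ?thesis using e by simp
    qed
    then show "\<exists>N. \<forall>n\<ge>N. norm (onorm (\<lambda>x. poly_op (p n) T x - S x) - 0) < e" by blast
  qed
qed

lemma is_fun_calc_poly:
  assumes "selfadjoint T" "\<And>s. s \<in> real_spectrum T \<Longrightarrow> f s = poly p s"
  shows "is_fun_calc f T (poly_op p T)"
proof (rule is_fun_calc_if_pointwise[OF assms(1)])
  show "uniform_limit (real_spectrum T) (\<lambda>n. poly p) f sequentially"
    by (rule uniform_limitI) (simp add: assms(2))
qed (simp_all add: bounded_op_poly_op adjoint_pairD[OF assms(1)])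

lemma is_fun_calc_ident:
  assumes T: "selfadjoint T" and f: "\<And>s. s \<in> real_spectrum T \<Longrightarrow> f s = s"
  shows "is_fun_calc f T T"
proof -
  have "poly_op [:0, 1:] T = T"
    using adjoint_pairD(1)[OF T] by (simp add: fun_eq_iff poly_op_pCons bounded_op_zero)
  then show ?thesis
    using is_fun_calc_poly[OF T, of f "[:0, 1:]"] f by simp
qed

lemma is_fun_calc_selfadjoint:
  assumes T: "selfadjoint T" and S: "is_fun_calc f T S"
  shows "selfadjoint S"
  unfolding adjoint_pair_def
proof (intro conjI allI is_fun_calc_bounded_op[OF S])
  fix x y
  obtain p where p: "\<And>y x. y \<longlonglongrightarrow> x \<Longrightarrow> (\<lambda>n. poly_op (p n) T (y n)) \<longlonglongrightarrow> S x"
    by (rule is_fun_calcE[OF adjoint_pairD(1)[OF T] S]) blast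
  have "(\<lambda>n. inner (poly_op (p n) T x) y) \<longlonglongrightarrow> inner (S x) y"
    by (intro tendsto_intros p[OF tendsto_const])
  moreover have "(\<lambda>n. inner (poly_op (p n) T x) y) \<longlonglongrightarrow> inner x (S y)"
    unfolding adjoint_pairD(3)[OF selfadjoint_poly_op[OF T]] by (intro tendsto_intros p[OF tendsto_const])
  ultimately show "inner (S x) y = inner x (S y)"
    by (rule LIMSEQ_unique)
qed

lemma is_fun_calc_eigenvector:
  assumes T: "bounded_op T" and S: "is_fun_calc f T S" and x: "T x = s *\<^sub>R x"
  shows "S x = f s *\<^sub>R x"
proof (cases "x = 0")
  case True
  then show ?thesis using is_fun_calc_bounded_op[OF S] by (simp add: bounded_op_zero)
next
  case False
  obtain p where p: "uniform_limit (real_spectrum T) (\<lambda>n. poly (p n)) f sequentially"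
    "\<And>y x. y \<longlonglongrightarrow> x \<Longrightarrow> (\<lambda>n. poly_op (p n) T (y n)) \<longlonglongrightarrow> S x"
    by (rule is_fun_calcE[OF T S]) blast
  have "(\<lambda>n. poly (p n) s) \<longlonglongrightarrow> f s"
    by (rule tendsto_uniform_limitI[OF p(1) eigenvalue_in_spectrum[of T x s, OF x False]])
  then have "(\<lambda>n. poly_op (p n) T x) \<longlonglongrightarrow> f s *\<^sub>R x"
    unfolding poly_op_eigenvector[OF T x] by (intro tendsto_intros)
  moreover have "(\<lambda>n. poly_op (p n) T x) \<longlonglongrightarrow> S x"
    by (rule p(2)[OF tendsto_const])
  ultimately show ?thesis by (rule LIMSEQ_unique[rotated])
qed

lemma bounded_image_if_uniform_limit_poly:
  assumes T: "bounded_op T" and p: "uniform_limit (real_spectrum T) (\<lambda>n. poly (p n)) f sequentially"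
  shows "bounded (f ` real_spectrum T)"
proof -
  obtain M where M: "real_spectrum T \<subseteq> {- M..M}"
    using real_spectrum_bounded[OF T] by blast
  obtain N where N: "\<forall>s\<in>real_spectrum T. dist (poly (p N) s) (f s) < 1"
    using uniform_limitD[OF p, of 1] by (auto simp: eventually_sequentially)
  have "bounded (poly (p N) ` {- M..M})"
    by (intro compact_imp_bounded compact_continuous_image continuous_intros) auto
  then obtain B where B: "\<And>s. s \<in> {- M..M} \<Longrightarrow> \<bar>poly (p N) s\<bar> \<le> B"
    unfolding bounded_iff real_norm_def by blast
  have "\<bar>f s\<bar> \<le> B + 1" if "s \<in> real_spectrum T" for s
    using bspec[OF N that] B[of s] M that unfolding dist_real_def by (smt (verit) subsetD)
  then show ?thesis by (auto simp: bounded_iff)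
qed

lemma is_fun_calc_mult:
  assumes T: "selfadjoint T" and S: "is_fun_calc f T S" and R: "is_fun_calc g T R"
  shows "is_fun_calc (\<lambda>s. f s * g s) T (\<lambda>x. S (R x))"
proof -
  note op = adjoint_pairD(1)[OF T]
  obtain p where p: "uniform_limit (real_spectrum T) (\<lambda>n. poly (p n)) f sequentially"
    "\<And>y x. y \<longlonglongrightarrow> x \<Longrightarrow> (\<lambda>n. poly_op (p n) T (y n)) \<longlonglongrightarrow> S x"
    by (rule is_fun_calcE[OF op S]) blast
  obtain r where r: "uniform_limit (real_spectrum T) (\<lambda>n. poly (r n)) g sequentially"
    "\<And>y x. y \<longlonglongrightarrow> x \<Longrightarrow> (\<lambda>n. poly_op (r n) T (y n)) \<longlonglongrightarrow> R x"
    by (rule is_fun_calcE[OF op R]) blast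
  have "uniform_limit (real_spectrum T) (\<lambda>n s. poly (p n) s * poly (r n) s) (\<lambda>s. f s * g s) sequentially"
    by (intro uniform_lim_mult p r bounded_image_if_uniform_limit_poly[OF op p(1)]
        bounded_image_if_uniform_limit_poly[OF op r(1)])
  moreover have "poly (p n * r n) = (\<lambda>s. poly (p n) s * poly (r n) s)" for n
    by (rule ext) simp
  ultimately have "uniform_limit (real_spectrum T) (\<lambda>n. poly (p n * r n)) (\<lambda>s. f s * g s) sequentially"
    by (simp only:)
  moreover have "(\<lambda>n. poly_op (p n * r n) T x) \<longlonglongrightarrow> S (R x)" for x
    unfolding poly_op_mult[OF op] by (rule p(2)[OF r(2)[OF tendsto_const]])
  ultimately show ?thesis
    by (intro is_fun_calc_if_pointwise[where p = "\<lambda>n. p n * r n"] T bounded_op_comp[of S R]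
        is_fun_calc_bounded_op[OF S] is_fun_calc_bounded_op[OF R])
qed

lemma continuous_on_approx_poly:
  assumes "continuous_on {a..b} h" "e > 0"
  shows "\<exists>p :: real poly. \<forall>s\<in>{a..b}. \<bar>h s - poly p s\<bar> < e"
proof -
  obtain g where g: "real_polynomial_function g" "\<And>s. s \<in> {a..b} \<Longrightarrow> \<bar>h s - g s\<bar> < e"
    using Stone_Weierstrass_real_polynomial_function[OF compact_Icc assms] by blast
  then obtain c n where "g = (\<lambda>x. \<Sum>i\<le>n. c i * x ^ i)"
    using real_polynomial_function_iff_sum by blast
  then have "poly (\<Sum>i\<le>n. monom (c i) i) s = g s" for s
    by (simp add: poly_sum poly_monom)
  with g(2) show ?thesis by (metis (no_types, lifting))
qed

text \<open>Only the values of \<open>f\<close> on the spectrum matter, so \<open>f\<close> may jump elsewhere; this is what allows the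
  inverse square root at an isolated point \<open>0\<close>.\<close>
lemma is_fun_calc_exists:
  assumes T: "selfadjoint T" and h: "continuous_on UNIV h"
    and eq: "\<And>s. s \<in> real_spectrum T \<Longrightarrow> f s = h s"
  shows "\<exists>S. is_fun_calc f T S"
proof -
  note op = adjoint_pairD(1)[OF T]
  obtain M where M: "real_spectrum T \<subseteq> {- M..M}"
    using real_spectrum_bounded[OF op] by blast
  have "\<exists>p. \<forall>s\<in>{- M..M}. \<bar>h s - poly p s\<bar> < inverse (real (Suc n))" for n
    by (rule continuous_on_approx_poly[OF continuous_on_subset[OF h]]) auto
  then obtain p where p: "\<And>n s. s \<in> {- M..M} \<Longrightarrow> \<bar>h s - poly (p n) s\<bar> < inverse (real (Suc n))"
    by metis
  have lim: "uniform_limit (real_spectrum T) (\<lambda>n. poly (p n)) f sequentially"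
  proof (rule uniform_limitI)
    fix e :: real assume "e > 0"
    with LIMSEQ_inverse_real_of_nat have "\<forall>\<^sub>F n in sequentially. inverse (real (Suc n)) < e"
      by (rule order_tendstoD)
    then show "\<forall>\<^sub>F n in sequentially. \<forall>s\<in>real_spectrum T. dist (poly (p n) s) (f s) < e"
    proof eventually_elim
      case (elim n)
      show ?case
      proof
        fix s assume "s \<in> real_spectrum T"
        with p[of s n] M eq[of s] elim show "dist (poly (p n) s) (f s) < e"
          by (auto simp: dist_real_def abs_minus_commute)
      qed
    qed
  qed
  note Cauchy = poly_op_uniformly_Cauchy[OF T _ lim lim]
  have "Cauchy (\<lambda>n. poly_op (p n) T x)" for x
  proof (rule CauchyI)
    fix e :: real assume e: "e > 0"
    define d where "d = e / (norm x + 1)"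
    have nx: "norm x + 1 > 0" by (simp add: add_nonneg_pos)
    have "d > 0" using e nx by (simp add: d_def)
    have "d * norm x < e"
      using e nx by (simp add: d_def field_simps)
    with Cauchy[OF \<open>d > 0\<close>]
    show "\<exists>N. \<forall>m\<ge>N. \<forall>n\<ge>N. norm (poly_op (p m) T x - poly_op (p n) T x) < e"
      by (meson le_less_trans)
  qed
  then have "\<forall>x. \<exists>y. (\<lambda>n. poly_op (p n) T x) \<longlonglongrightarrow> y"
    by (simp add: Cauchy_convergent_iff convergent_def)
  then obtain S where S: "\<And>x. (\<lambda>n. poly_op (p n) T x) \<longlonglongrightarrow> S x" by metis
  note poly_op = bounded_op_poly_op[OF op]
  obtain N where N: "\<And>m n x. m \<ge> N \<Longrightarrow> n \<ge> N \<Longrightarrow>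
      norm (poly_op (p m) T x - poly_op (p n) T x) \<le> 1 * norm x"
    using Cauchy[of 1] by auto
  have "bounded_op S"
    unfolding bounded_op_def
  proof (intro conjI allI bounded_linear_intro[where K = "1 + onorm (poly_op (p N) T)"])
    fix x y :: ell2 and r :: real and a :: complex
    have "(\<lambda>n. poly_op (p n) T (x + y)) \<longlonglongrightarrow> S x + S y"
      unfolding bounded_op_add[OF poly_op] by (intro tendsto_intros S)
    then show "S (x + y) = S x + S y" using S LIMSEQ_unique by blast
    have "(\<lambda>n. poly_op (p n) T (r *\<^sub>R x)) \<longlonglongrightarrow> r *\<^sub>R S x"
      unfolding bounded_op_scaleR[OF poly_op] by (intro tendsto_intros S)
    then show "S (r *\<^sub>R x) = r *\<^sub>R S x" using S LIMSEQ_unique by blast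
    have "(\<lambda>n. poly_op (p n) T (a *\<^sub>C x)) \<longlonglongrightarrow> a *\<^sub>C S x"
      unfolding bounded_op_scaleC[OF poly_op]
      by (rule bounded_linear.tendsto[OF bounded_linear_scaleC S])
    then show "S (a *\<^sub>C x) = a *\<^sub>C S x" using S LIMSEQ_unique by blast
    have "norm (poly_op (p n) T x) \<le> norm x * (1 + onorm (poly_op (p N) T))" if "n \<ge> N" for n
      using N[OF that order_refl, of x] onorm[OF bounded_op_bounded_linear[OF poly_op], of "p N" x]
        norm_triangle_sub[of "poly_op (p n) T x" "poly_op (p N) T x"]
      by (simp add: algebra_simps)
    then show "norm (S x) \<le> norm x * (1 + onorm (poly_op (p N) T))"
      by (intro LIMSEQ_le_const2[OF tendsto_norm[OF S]]) blast
  qed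
  then show ?thesis
    using is_fun_calc_if_pointwise[OF T _ lim] S by blast
qed

section \<open>Polar decomposition in the presence of a spectral gap\<close>

definition rsqrt :: "real \<Rightarrow> real" where
  "rsqrt = (\<lambda>s. if s = 0 then 0 else s powr (- 1 / 2))"

lemma rsqrt_eq: "s > 0 \<Longrightarrow> rsqrt s = 1 / sqrt s"
  using powr_minus_divide[of s "1 / 2"] powr_half_sqrt[of s] by (simp add: rsqrt_def)

lemma inv_sqrt_op_eq: "inv_sqrt_op = fun_calc rsqrt"
  by (simp add: inv_sqrt_op_def rsqrt_def fun_eq_iff)

text \<open>The setting of \<^const>\<open>isometric_part\<close>: \<open>0\<close> is at most an isolated point of the spectrum of
  \<open>X\<^sup>* X\<close>, where \<open>Y = X\<^sup>*\<close>.\<close>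
locale spectral_gap =
  fixes X Y :: "ell2 \<Rightarrow> ell2" and d :: real
  assumes pair: "adjoint_pair X Y" and d_pos: "d > 0"
    and gap: "\<And>s. s \<in> real_spectrum (Y \<circ> X) \<Longrightarrow> s = 0 \<or> d \<le> s"
begin

lemma spectrum_nonneg: "s \<in> real_spectrum (Y \<circ> X) \<Longrightarrow> s \<ge> 0"
  using gap[of s] d_pos by auto

lemma comp_selfadjoint: "selfadjoint (Y \<circ> X)"
  by (rule selfadjoint_adjoint_comp[OF pair])

lemma is_fun_calc_sqrt: "is_fun_calc sqrt (Y \<circ> X) (sqrt_op (Y \<circ> X))"
proof -
  obtain S where "is_fun_calc sqrt (Y \<circ> X) S"
    using is_fun_calc_exists[OF comp_selfadjoint continuous_on_real_sqrt[OF continuous_on_id], of sqrt]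
    by blast
  then show ?thesis
    using fun_calc_eqI[OF comp_selfadjoint] by (simp add: sqrt_op_def)
qed

lemma is_fun_calc_inv_sqrt: "is_fun_calc rsqrt (Y \<circ> X) (inv_sqrt_op (Y \<circ> X))"
proof -
  \<comment> \<open>A continuous function on the whole line with \<open>h 0 = 0\<close> and \<open>h s = s powr (-1/2)\<close> for \<open>s \<ge> d\<close>.\<close>
  define h where "h s = s * max s d powr (- 3 / 2)" for s :: real
  have "continuous_on UNIV h"
    unfolding h_def using d_pos by (intro continuous_intros) (auto simp: max_def)
  moreover have "rsqrt s = h s" if "s \<in> real_spectrum (Y \<circ> X)" for s
  proof (cases "s = 0")
    case False
    then have "s \<ge> d" "s > 0" using gap[OF that] d_pos by auto
    then have "h s = s powr 1 * s powr (- 3 / 2)" by (simp add: h_def max_absorb1)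
    also have "\<dots> = s powr (1 + - 3 / 2)" by (rule powr_add[symmetric])
    finally show ?thesis using False by (simp add: rsqrt_def)
  qed (simp add: h_def rsqrt_def)
  ultimately obtain S where "is_fun_calc rsqrt (Y \<circ> X) S"
    using is_fun_calc_exists[OF comp_selfadjoint, of h rsqrt] by auto
  then show ?thesis
    using fun_calc_eqI[OF comp_selfadjoint] by (simp add: inv_sqrt_op_eq)
qed

lemma isometric_part_eq: "isometric_part X = (\<lambda>x. X (inv_sqrt_op (Y \<circ> X) x))"
  by (simp add: isometric_part_def adj_eqI[OF pair] o_def)

lemma adj_isometric_part_eq: "adj (isometric_part X) = (\<lambda>x. inv_sqrt_op (Y \<circ> X) (Y x))"
  unfolding isometric_part_eq
  by (rule adj_eqI[OF adjoint_pair_comp[OF pair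
        is_fun_calc_selfadjoint[OF comp_selfadjoint is_fun_calc_inv_sqrt]]])

text \<open>If \<open>f = 1\<close> on the non-zero spectrum, then \<open>f(X\<^sup>* X)\<close> is the projection onto the orthogonal complement
  of \<open>ker X\<close>. Indeed \<open>s f(s) = s\<close> on the spectrum, so \<open>X\<^sup>* X (f(X\<^sup>* X) - 1) = 0\<close>, and \<open>X\<^sup>* X\<close> and \<open>X\<close> have
  the same kernel. The second claim is the adjoint of the first.\<close>
lemma
  assumes S: "is_fun_calc f (Y \<circ> X) S"
    and f: "\<And>s. s \<in> real_spectrum (Y \<circ> X) \<Longrightarrow> s \<noteq> 0 \<Longrightarrow> f s = 1"
  shows support_right: "X (S x) = X x" and support_left: "S (Y y) = Y y"
proof -
  note self = comp_selfadjoint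
  note op = adjoint_pairD(1)[OF pair] adjoint_pairD(2)[OF pair]
  have "is_fun_calc (\<lambda>s. s * f s) (Y \<circ> X) (\<lambda>x. (Y \<circ> X) (S x))"
    by (rule is_fun_calc_mult[OF self is_fun_calc_ident[OF self refl] S])
  moreover have "is_fun_calc (\<lambda>s. s * f s) (Y \<circ> X) (Y \<circ> X)"
    by (rule is_fun_calc_ident[OF self]) (use f in auto)
  ultimately have AS: "(\<lambda>x. (Y \<circ> X) (S x)) = Y \<circ> X"
    by (rule is_fun_calc_unique[OF self])
  have right: "X (S x) = X x" for x
  proof -
    have "Y (X (S x - x)) = 0"
      using fun_cong[OF AS, of x] by (simp add: bounded_op_diff[OF op(1)] bounded_op_diff[OF op(2)])
    then have "(norm (X (S x - x)))\<^sup>2 = 0"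
      by (simp flip: adjoint_pair_inner_sq[OF pair])
    then show ?thesis by (simp add: bounded_op_diff[OF op(1)])
  qed
  show "X (S x) = X x" by (rule right)
  have "inner z (S (Y y)) = inner z (Y y)" for z
  proof -
    have "inner z (S (Y y)) = inner (S z) (Y y)"
      by (rule adjoint_pairD(3)[OF is_fun_calc_selfadjoint[OF self S], symmetric])
    also have "\<dots> = inner (X (S z)) y" by (rule adjoint_pairD(3)[OF pair, symmetric])
    also have "\<dots> = inner z (Y y)" unfolding right by (rule adjoint_pairD(3)[OF pair])
    finally show ?thesis .
  qed
  then have "inner (S (Y y) - Y y) (S (Y y) - Y y) = 0"
    by (simp add: inner_diff_right)
  then show "S (Y y) = Y y" by simp
qed

lemma sqrt_rsqrt:
  assumes "s \<in> real_spectrum (Y \<circ> X)" "s \<noteq> 0"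
  shows "sqrt s * rsqrt s = 1" "rsqrt s * sqrt s = 1" "s * (rsqrt s * rsqrt s) = 1"
proof -
  have "s > 0" using spectrum_nonneg[OF assms(1)] assms(2) by simp
  moreover have "s / (sqrt s * sqrt s) = 1" using calculation by simp
  ultimately show "sqrt s * rsqrt s = 1" "rsqrt s * sqrt s = 1" "s * (rsqrt s * rsqrt s) = 1"
    by (simp_all only: rsqrt_eq times_divide_eq_left times_divide_eq_right mult_1_left mult_1_right
      divide_divide_eq_left) simp_all
qed

lemma polar_decomposition: "isometric_part X (sqrt_op (Y \<circ> X) x) = X x"
  unfolding isometric_part_eq
  by (rule support_right[OF is_fun_calc_mult[OF comp_selfadjoint is_fun_calc_inv_sqrt is_fun_calc_sqrt]])
     (rule sqrt_rsqrt(2))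

lemma polar_decomposition_adj: "sqrt_op (Y \<circ> X) (adj (isometric_part X) y) = Y y"
  unfolding adj_isometric_part_eq
  by (rule support_left[OF is_fun_calc_mult[OF comp_selfadjoint is_fun_calc_sqrt is_fun_calc_inv_sqrt]])
     (rule sqrt_rsqrt(1))

text \<open>\<open>1 - V V\<^sup>*\<close>, with \<open>V\<close> the isometric part of \<open>X\<close>, maps into the kernel of \<open>X\<^sup>*\<close>.\<close>
lemma range_projection: "Y (isometric_part X (adj (isometric_part X) y)) = Y y"
proof -
  note mult = is_fun_calc_mult[OF comp_selfadjoint]
  have "(Y \<circ> X) (inv_sqrt_op (Y \<circ> X) (inv_sqrt_op (Y \<circ> X) (Y y))) = Y y"
    by (rule support_left[OF mult[OF is_fun_calc_ident[OF comp_selfadjoint refl] mult[OF is_fun_calc_inv_sqrt is_fun_calc_inv_sqrt]]])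
       (rule sqrt_rsqrt(3))
  then show ?thesis
    unfolding adj_isometric_part_eq unfolding isometric_part_eq by simp
qed

lemma inv_sqrt_op_eigenvector:
  assumes "Y (X x) = s *\<^sub>R x" "s > 0"
  shows "inv_sqrt_op (Y \<circ> X) x = (1 / sqrt s) *\<^sub>R x"
proof -
  have "inv_sqrt_op (Y \<circ> X) x = rsqrt s *\<^sub>R x"
    by (rule is_fun_calc_eigenvector[OF adjoint_pairD(1)[OF comp_selfadjoint] is_fun_calc_inv_sqrt])
       (simp add: assms(1))
  also have "rsqrt s = 1 / sqrt s"
    by (rule rsqrt_eq[OF assms(2)])
  finally show ?thesis .
qed

end


section \<open>Orthogonality and weighted shifts\<close>

lemma inner_imaginary_multiple: "inner x (\<i> *\<^sub>C x) = 0"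
  using inner_scaleC_left[of \<i> x x] by (simp add: inner_commute)

lemma cinner_self: "cinner x x = of_real ((norm x)\<^sup>2)"
  by (simp add: cinner_eq_inner inner_imaginary_multiple power2_norm_eq_inner complex_eq_iff)

text \<open>The imaginary part of \<open>\<langle>x, y\<rangle>\<close> is the real inner product of \<open>x\<close> with \<open>\<i> y\<close>, which is an eigenvector
  for the same eigenvalue as \<open>y\<close>.\<close>
lemma eigenvectors_orthogonal:
  assumes T: "selfadjoint T" and x: "T x = s *\<^sub>R x" and y: "T y = r *\<^sub>R y" and ne: "s \<noteq> r"
  shows "cinner x y = 0"
proof -
  have orth: "inner x z = 0" if "T z = r *\<^sub>R z" for z
    using adjoint_pairD(3)[OF T, of x z] x that ne by simp
  have "T (\<i> *\<^sub>C y) = \<i> *\<^sub>C (of_real r *\<^sub>C y)"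
    using bounded_op_scaleC[OF adjoint_pairD(1)[OF T]] y by (simp add: scaleC_of_real)
  then have "T (\<i> *\<^sub>C y) = r *\<^sub>R (\<i> *\<^sub>C y)"
    by (simp add: mult.commute flip: scaleC_of_real)
  then show ?thesis
    using orth y by (simp add: cinner_eq_inner complex_eq_iff)
qed

lemma weighted_shift_onI:
  assumes T: "bounded_op T" and ortho: "\<And>m n. cinner (b m) (b n) = of_bool (m = n)"
    and shift: "\<And>n. T (b n) = w n *\<^sub>C b (Suc n)"
  shows "weighted_shift_on (closure (ell2.span (range b))) b T"
  unfolding weighted_shift_on_def orthonormal_basis_of_def
proof (intro conjI allI exI[of _ w] ortho refl T shift)
  have norm_b: "norm (b n) = 1" for n
  proof -
    have "of_real ((norm (b n))\<^sup>2) = (1 :: complex)"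
      using ortho[of n n] by (simp add: cinner_self)
    then have "(norm (b n))\<^sup>2 = 1" by (simp only: of_real_eq_1_iff)
    then have "norm (b n) = 1 \<or> norm (b n) = - 1" by (simp only: power2_eq_1_iff)
    then show ?thesis using norm_ge_zero[of "b n"] by linarith
  qed
  have "cmod (w n) \<le> onorm T" for n
    using onorm[OF bounded_op_bounded_linear[OF T], of "b n"] by (simp add: shift norm_scaleC norm_b)
  then show "bounded (range w)" by (auto simp: bounded_iff)
  have span: "T x \<in> ell2.span (range b)" if "x \<in> ell2.span (range b)" for x
    using that
  proof (rule ell2.span_induct)
    show "ell2.subspace {x. T x \<in> ell2.span (range b)}"
      by (simp add: ell2.subspace_def bounded_op_zero[OF T] bounded_op_add[OF T] bounded_op_scaleC[OF T]
          ell2.span_zero ell2.span_add ell2.span_scale)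
    fix x assume "x \<in> range b"
    then obtain n where "x = b n" by blast
    then show "T x \<in> ell2.span (range b)"
      using ell2.span_scale[OF ell2.span_base[of "b (Suc n)" "range b"], of "w n"] by (simp add: shift)
  qed
  show "T ` closure (ell2.span (range b)) \<subseteq> closure (ell2.span (range b))"
  proof (rule image_closure_subset)
    show "continuous_on (closure (ell2.span (range b))) T"
      by (rule linear_continuous_on[OF bounded_op_bounded_linear[OF T]])
    show "T ` ell2.span (range b) \<subseteq> closure (ell2.span (range b))"
      using span closure_subset[of "ell2.span (range b)"] by (meson image_subsetI subsetD)
  qed simp
qed

section \<open>The operators \<open>x\<^sub>1\<close> and \<open>x\<^sub>2\<close>\<close>

text \<open>At \<open>n = 0\<close> the truncated index \<open>n - 1\<close> is harmless because the weight vanishes there.\<close>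
definition alpha_star :: "real \<Rightarrow> ell2 \<Rightarrow> ell2" where
  "alpha_star q x = Abs_ell2 (\<lambda>n. complex_of_real (sqrt (1 - 1 / q ^ (2 * n))) * coord x (n - 1))"

lemma coord_alpha_star:
  assumes "q > 1"
  shows "coord (alpha_star q x) n = complex_of_real (sqrt (1 - 1 / q ^ (2 * n))) * coord x (n - 1)"
proof -
  have "cmod (complex_of_real (sqrt (1 - 1 / q ^ (2 * n)))) \<le> 1" for n
    using alpha_weight_le_1[OF assms, of "n - 1"] by (cases n) simp_all
  moreover have "summable (\<lambda>n. (cmod (coord x (n - 1)))\<^sup>2)"
    using summable_coord[of x] by (subst summable_Suc_iff[symmetric]) simp
  ultimately show ?thesis
    unfolding alpha_star_def using sq_summable_mult_bounded(1) by (subst Abs_ell2_inverse) auto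
qed

lemma inner_eq_suminf: "inner x y = (\<Sum>n. Re (coord x n * cnj (coord y n)))"
  unfolding inner_ell2_def cinner_def by (rule Re_suminf[OF summable_cinner])

lemma alpha_adjoint:
  assumes "q > 1"
  shows "adjoint_pair (alpha q) (alpha_star q)"
proof (rule adjoint_pairI[OF bounded_op_alpha[OF assms]])
  fix x y
  define f where "f n = Re (coord x n * cnj (coord (alpha_star q y) n))" for n
  have "summable f"
    unfolding f_def by (rule summable_Re[OF summable_cinner])
  have "f 0 = 0"
    by (simp add: f_def coord_alpha_star[OF assms])
  have "inner (alpha q x) y = (\<Sum>n. f (Suc n))"
    by (simp add: inner_eq_suminf f_def coord_alpha[OF assms] coord_alpha_star[OF assms] mult_ac)
  also have "\<dots> = (\<Sum>n. f n)"
    using suminf_split_head[OF \<open>summable f\<close>] \<open>f 0 = 0\<close> by simp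
  also have "\<dots> = inner x (alpha_star q y)"
    by (simp add: inner_eq_suminf f_def)
  finally show "inner (alpha q x) y = inner x (alpha_star q y)" .
qed

lemma gamma_selfadjoint: "q > 1 \<Longrightarrow> selfadjoint (gamma q)"
  by (rule adjoint_pairI[OF bounded_op_gamma])
     (simp_all add: inner_eq_suminf coord_gamma mult_ac)

locale x_operators =
  fixes q c :: real and t1 :: complex
  assumes q: "q > 1" and c: "c > 0" and t1: "cmod t1 = 1"
begin

abbreviation X1 where "X1 \<equiv> x1 q c t1"
abbreviation X2 where "X2 \<equiv> x2 q c t1"

definition Y1 :: "ell2 \<Rightarrow> ell2" where
  "Y1 \<xi> = cnj (complex_of_real (sqrt c) * t1) *\<^sub>C alpha_star q \<xi> + t1 *\<^sub>C gamma q \<xi>"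

definition Y2 :: "ell2 \<Rightarrow> ell2" where
  "Y2 \<xi> = cnj (- complex_of_real (sqrt c / q) * t1) *\<^sub>C gamma q \<xi> + t1 *\<^sub>C alpha q \<xi>"

lemma X2_eq: "X2 \<xi> = (- complex_of_real (sqrt c / q) * t1) *\<^sub>C gamma q \<xi> + cnj t1 *\<^sub>C alpha_star q \<xi>"
  by (simp add: x2_def adj_eqI[OF alpha_adjoint[OF q]])

lemma pair1: "adjoint_pair X1 Y1"
  using adjoint_pair_plus[OF adjoint_pair_scaleC[OF alpha_adjoint[OF q]]
      adjoint_pair_scaleC[OF gamma_selfadjoint[OF q]], of "complex_of_real (sqrt c) * t1" "cnj t1"]
  by (simp add: x1_def[abs_def] Y1_def[abs_def])

lemma pair2: "adjoint_pair X2 Y2"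
  using adjoint_pair_plus[OF adjoint_pair_scaleC[OF gamma_selfadjoint[OF q]]
      adjoint_pair_scaleC[OF adjoint_pair_sym[OF alpha_adjoint[OF q]]],
      of "- complex_of_real (sqrt c / q) * t1" "cnj t1"]
  by (simp add: X2_eq[abs_def] Y2_def[abs_def])

definition root_c :: complex where "root_c = complex_of_real (sqrt c)"
definition q_inv :: complex where "q_inv = complex_of_real (1 / q)"
definition alpha_weight :: "nat \<Rightarrow> complex" where "alpha_weight n = complex_of_real (sqrt (1 - 1 / q ^ (2 * n)))"
definition gamma_weight :: "nat \<Rightarrow> complex" where "gamma_weight n = complex_of_real (1 / q ^ n)"

lemma coord_X1: "coord (X1 x) n = root_c * t1 * (alpha_weight (Suc n) * coord x (Suc n))
    + cnj t1 * (gamma_weight n * coord x n)"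
  by (simp add: x1_def coord_alpha[OF q] coord_gamma[OF q] root_c_def alpha_weight_def gamma_weight_def)

lemma coord_Y1: "coord (Y1 x) n = root_c * cnj t1 * (alpha_weight n * coord x (n - 1))
    + t1 * (gamma_weight n * coord x n)"
  by (simp add: Y1_def coord_alpha_star[OF q] coord_gamma[OF q] root_c_def alpha_weight_def gamma_weight_def)

lemma coord_X2: "coord (X2 x) n = - (q_inv * root_c * t1 * (gamma_weight n * coord x n))
    + cnj t1 * (alpha_weight n * coord x (n - 1))"
  by (simp add: X2_eq coord_alpha_star[OF q] coord_gamma[OF q] root_c_def alpha_weight_def gamma_weight_def q_inv_def)

lemma coord_Y2: "coord (Y2 x) n = - (q_inv * root_c * cnj t1 * (gamma_weight n * coord x n))
    + t1 * (alpha_weight (Suc n) * coord x (Suc n))"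
  by (simp add: Y2_def coord_alpha[OF q] coord_gamma[OF q] root_c_def alpha_weight_def gamma_weight_def q_inv_def)

lemma alpha_weight_sq: "(alpha_weight n)\<^sup>2 = 1 - (gamma_weight n)\<^sup>2"
proof -
  have "1 / q ^ (2 * n) \<le> 1"
    using q by (simp add: one_le_power)
  then have "(sqrt (1 - 1 / q ^ (2 * n)))\<^sup>2 = 1 - 1 / q ^ (2 * n)"
    by simp
  also have "\<dots> = 1 - (1 / q ^ n)\<^sup>2"
    by (simp add: power_divide power_mult[symmetric] mult.commute)
  finally show ?thesis
    unfolding alpha_weight_def gamma_weight_def by (metis of_real_1 of_real_diff of_real_power)
qed

lemma alpha_weight_0: "alpha_weight 0 = 0" and gamma_weight_Suc: "gamma_weight (Suc n) = q_inv * gamma_weight n"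
  by (simp_all add: alpha_weight_def gamma_weight_def q_inv_def)

lemma t1_unit: "t1 * cnj t1 = 1"
  using t1 by (simp add: complex_norm_square[symmetric])

lemma root_c_sq: "root_c\<^sup>2 = complex_of_real c"
  using c by (simp add: root_c_def flip: of_real_power)

text \<open>This identity and the next hold because the weights \<open>w\<^sub>n\<close> of \<open>\<alpha>\<close> and \<open>g\<^sub>n\<close> of \<open>\<gamma>\<close> satisfy
  \<open>w\<^sub>n\<^sup>2 + g\<^sub>n\<^sup>2 = 1\<close> and \<open>g\<^sub>n\<^sub>+\<^sub>1 = g\<^sub>n / q\<close>; the off-diagonal terms of the two summands cancel. They tie the spectral theory of \<open>x\<^sub>2\<close> to that of \<open>x\<^sub>1\<close>, on the side of the
  ranges (\<open>x\<^sub>i x\<^sub>i\<^sup>*\<close>) and on the side of the supports (\<open>x\<^sub>i\<^sup>* x\<^sub>i\<close>).\<close>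
lemma sum_of_ranges: "X1 (Y1 \<xi>) + X2 (Y2 \<xi>) = (1 + c) *\<^sub>R \<xi>"
proof (rule ell2_eqI)
  fix n
  have "coord (X1 (Y1 \<xi>)) n + coord (X2 (Y2 \<xi>)) n = (t1 * cnj t1) *
      (root_c\<^sup>2 * ((alpha_weight (Suc n))\<^sup>2 + q_inv\<^sup>2 * (gamma_weight n)\<^sup>2) + (gamma_weight n)\<^sup>2 + 
        (alpha_weight n)\<^sup>2) * coord \<xi> n"
    by (cases n) (simp_all add: coord_X1 coord_Y1 coord_X2 coord_Y2
      gamma_weight_Suc alpha_weight_0 algebra_simps power2_eq_square)
  also have "\<dots> = (1 + complex_of_real c) * coord \<xi> n"
    by (simp add: root_c_sq t1_unit alpha_weight_sq gamma_weight_Suc power_mult_distrib add.commute)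
  finally show "coord (X1 (Y1 \<xi>) + X2 (Y2 \<xi>)) n = coord ((1 + c) *\<^sub>R \<xi>) n"
    by (simp add: scaleR_conv_of_real)
qed

lemma sum_of_supports: "Y2 (X2 \<xi>) + (1 / q\<^sup>2) *\<^sub>R Y1 (X1 \<xi>) = (1 + c / q\<^sup>2) *\<^sub>R \<xi>"
proof (rule ell2_eqI)
  fix n
  have "coord (Y2 (X2 \<xi>)) n + q_inv\<^sup>2 * coord (Y1 (X1 \<xi>)) n = (t1 * cnj t1) *
      (q_inv\<^sup>2 * root_c\<^sup>2 * ((gamma_weight n)\<^sup>2 + (alpha_weight n)\<^sup>2) + (alpha_weight (Suc n))\<^sup>2 + q_inv\<^sup>2 * (gamma_weight n)\<^sup>2) * coord \<xi> n"
    by (cases n) (simp_all add: coord_X1 coord_Y1 coord_X2 coord_Y2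
      gamma_weight_Suc alpha_weight_0 algebra_simps power2_eq_square)
  also have "\<dots> = (1 + complex_of_real c * q_inv\<^sup>2) * coord \<xi> n"
    by (simp add: root_c_sq t1_unit alpha_weight_sq gamma_weight_Suc power_mult_distrib mult.commute add.commute)
  finally show "coord (Y2 (X2 \<xi>) + (1 / q\<^sup>2) *\<^sub>R Y1 (X1 \<xi>)) n = coord ((1 + c / q\<^sup>2) *\<^sub>R \<xi>) n"
    by (simp add: scaleR_conv_of_real q_inv_def power_divide)
qed

lemma norm_ranges: "(norm (Y1 \<xi>))\<^sup>2 + (norm (Y2 \<xi>))\<^sup>2 = (1 + c) * (norm \<xi>)\<^sup>2"
  using arg_cong[OF sum_of_ranges[of \<xi>], of "\<lambda>u. inner u \<xi>"]
  by (simp add: inner_add_left adjoint_pair_inner_sq[OF adjoint_pair_sym[OF pair1]]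
      adjoint_pair_inner_sq[OF adjoint_pair_sym[OF pair2]] flip: power2_norm_eq_inner)

lemma norm_supports: "(norm (X2 \<xi>))\<^sup>2 + (norm (X1 \<xi>))\<^sup>2 / q\<^sup>2 = (1 + c / q\<^sup>2) * (norm \<xi>)\<^sup>2"
  using arg_cong[OF sum_of_supports[of \<xi>], of "\<lambda>u. inner u \<xi>"]
  by (simp add: inner_add_left adjoint_pair_inner_sq[OF pair1]
      adjoint_pair_inner_sq[OF pair2] flip: power2_norm_eq_inner)

lemma q_sq: "1 / q\<^sup>2 < 1" "0 < 1 / q\<^sup>2" "c / q\<^sup>2 < c"
proof -
  have "1 < q\<^sup>2" using q by simp
  then show "1 / q\<^sup>2 < 1" "0 < 1 / q\<^sup>2" "c / q\<^sup>2 < c"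
    using c q by (simp_all add: divide_less_eq)
qed

text \<open>From \<open>x\<^sub>2\<^sup>* x\<^sub>2 \<le> 1 + c / q\<^sup>2\<close> also \<open>x\<^sub>2 x\<^sub>2\<^sup>* \<le> 1 + c / q\<^sup>2\<close>, hence
  \<open>x\<^sub>1 x\<^sub>1\<^sup>* = 1 + c - x\<^sub>2 x\<^sub>2\<^sup>* \<ge> c - c / q\<^sup>2\<close>. Away from \<open>0\<close>, \<open>x\<^sub>1\<^sup>* x\<^sub>1\<close> has no more spectrum than \<open>x\<^sub>1 x\<^sub>1\<^sup>*\<close>.\<close>
sublocale gap1: spectral_gap X1 Y1 "c - c / q\<^sup>2"
proof
  show "adjoint_pair X1 Y1" by (rule pair1)
  show "0 < c - c / q\<^sup>2" using q_sq by simp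
  fix s assume s: "s \<in> real_spectrum (Y1 \<circ> X1)"
  have "(norm (X2 x))\<^sup>2 \<le> (1 + c / q\<^sup>2) * (norm x)\<^sup>2" for x
    using norm_supports[of x] zero_le_power2[of "norm (X1 x) / q"] unfolding power_divide by linarith
  then have "(norm (Y2 x))\<^sup>2 \<le> (1 + c / q\<^sup>2) * (norm x)\<^sup>2" for x
    by (rule norm_sq_adjoint_le[OF adjoint_pair_sym[OF pair2]])
  then have "(c - c / q\<^sup>2) * (norm x)\<^sup>2 \<le> inner ((X1 \<circ> Y1) x) x" for x
    using norm_ranges[of x] adjoint_pair_inner_sq[OF adjoint_pair_sym[OF pair1], of x]
    by (simp add: algebra_simps) (smt (verit))
  moreover have "bounded_op (X1 \<circ> Y1)"
    using bounded_op_comp[of X1 Y1] pair1 by (simp add: adjoint_pair_def o_def)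
  ultimately have "c - c / q\<^sup>2 \<le> s" if "s \<noteq> 0"
    using real_spectrum_ge[of "X1 \<circ> Y1" "c - c / q\<^sup>2" s]
      real_spectrum_comp_commute[OF adjoint_pairD(1,2)[OF pair1] s that] by blast
  then show "s = 0 \<or> c - c / q\<^sup>2 \<le> s" by blast
qed

text \<open>From \<open>x\<^sub>1 x\<^sub>1\<^sup>* \<le> 1 + c\<close> also \<open>x\<^sub>1\<^sup>* x\<^sub>1 \<le> 1 + c\<close>, hence
  \<open>x\<^sub>2\<^sup>* x\<^sub>2 = 1 + c / q\<^sup>2 - x\<^sub>1\<^sup>* x\<^sub>1 / q\<^sup>2 \<ge> 1 - 1 / q\<^sup>2\<close>.\<close>
sublocale gap2: spectral_gap X2 Y2 "1 - 1 / q\<^sup>2"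
proof
  show "adjoint_pair X2 Y2" by (rule pair2)
  show "0 < 1 - 1 / q\<^sup>2" using q_sq by simp
  fix s assume s: "s \<in> real_spectrum (Y2 \<circ> X2)"
  have "(norm (Y1 x))\<^sup>2 \<le> (1 + c) * (norm x)\<^sup>2" for x
    using norm_ranges[of x] zero_le_power2[of "norm (Y2 x)"] by linarith
  then have "(norm (X1 x))\<^sup>2 \<le> (1 + c) * (norm x)\<^sup>2" for x
    by (rule norm_sq_adjoint_le[OF pair1])
  then have le: "(norm (X1 x))\<^sup>2 / q\<^sup>2 \<le> (1 + c) * (norm x)\<^sup>2 / q\<^sup>2" for x
    by (rule divide_right_mono) simp
  have "(1 - 1 / q\<^sup>2) * (norm x)\<^sup>2 \<le> inner ((Y2 \<circ> X2) x) x" for x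
    using norm_supports[of x] le[of x] adjoint_pair_inner_sq[OF pair2, of x]
    by (simp add: algebra_simps add_divide_distrib)
  then show "s = 0 \<or> 1 - 1 / q\<^sup>2 \<le> s"
    using real_spectrum_ge[OF adjoint_pairD(1)[OF selfadjoint_adjoint_comp[OF pair2]] _ s] by blast
qed

end


section \<open>The chain of eigenvectors\<close>

context x_operators
begin

abbreviation W1 where "W1 \<equiv> isometric_part X1"
abbreviation W2 where "W2 \<equiv> isometric_part X2"

lemma factorization: "Y1 (X2 \<xi>) = sqrt_op (Y1 \<circ> X1) (adj W1 (W2 (sqrt_op (Y2 \<circ> X2) \<xi>)))"
  by (simp add: gap1.polar_decomposition_adj gap2.polar_decomposition)

text \<open>A \<open>k\<close>-eigenvector \<open>v\<close> of \<open>x\<^sub>1\<^sup>* x\<^sub>1\<close> is an \<open>a\<close>-eigenvector of \<open>x\<^sub>2\<^sup>* x\<^sub>2\<close>, so \<open>x\<^sub>2 v\<close> is an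
  \<open>a\<close>-eigenvector of \<open>x\<^sub>2 x\<^sub>2\<^sup>*\<close>, therefore a \<open>(1 + c - a)\<close>-eigenvector of \<open>x\<^sub>1 x\<^sub>1\<^sup>*\<close>, and \<open>x\<^sub>1\<^sup>* x\<^sub>2 v\<close> is an
  eigenvector of \<open>x\<^sub>1\<^sup>* x\<^sub>1\<close> for \<open>k' = 1 + c - a\<close>. On these vectors the inverse square roots in the
  isometric parts act as the scalars \<open>1 / \<surd>a\<close> and \<open>1 / \<surd>k'\<close>.\<close>
lemma eigenvector_step:
  assumes ev: "Y1 (X1 v) = k *\<^sub>R v" and k: "0 \<le> k" "k \<le> 1 + c"
  defines "k' \<equiv> c - c / q\<^sup>2 + k / q\<^sup>2" and "a \<equiv> 1 + c / q\<^sup>2 - k / q\<^sup>2"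
  shows "Y1 (X2 v) = (sqrt k' * sqrt a) *\<^sub>R adj W1 (W2 v)"
    and "Y1 (X1 (adj W1 (W2 v))) = k' *\<^sub>R adj W1 (W2 v)"
    and "norm (adj W1 (W2 v)) = norm v"
proof -
  note op1 = adjoint_pairD(1,2)[OF pair1] and op2 = adjoint_pairD(1,2)[OF pair2]
  have "k / q\<^sup>2 \<le> (1 + c) / q\<^sup>2" "0 \<le> k / q\<^sup>2"
    using k by (simp_all add: divide_right_mono)
  then have pos: "k' > 0" "a > 0"
    using q_sq unfolding k'_def a_def add_divide_distrib by linarith+
  have A2v: "Y2 (X2 v) = a *\<^sub>R v"
    using sum_of_supports[of v] by (simp add: ev a_def algebra_simps)
  have B1: "X1 (Y1 (X2 v)) = k' *\<^sub>R X2 v"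
  proof -
    have "X1 (Y1 (X2 v)) = (1 + c) *\<^sub>R X2 v - X2 (Y2 (X2 v))"
      using sum_of_ranges[of "X2 v"] by (simp add: algebra_simps)
    moreover have "k' = 1 + c - a" by (simp add: k'_def a_def)
    ultimately show ?thesis
      by (simp only: A2v bounded_op_scaleR[OF op2(1)] scaleR_diff_left)
  qed
  define u where "u = Y1 (X2 v)"
  have A1u: "Y1 (X1 u) = k' *\<^sub>R u"
    by (simp add: u_def B1 bounded_op_scaleR[OF op1(2)])
  note G = adjoint_pairD(1)[OF is_fun_calc_selfadjoint[OF gap1.comp_selfadjoint gap1.is_fun_calc_inv_sqrt]]
  have "W2 v = (1 / sqrt a) *\<^sub>R X2 v"
    by (simp add: gap2.isometric_part_eq gap2.inv_sqrt_op_eigenvector[OF A2v pos(2)]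
        bounded_op_scaleR[OF op2(1)])
  then have w: "adj W1 (W2 v) = (1 / (sqrt k' * sqrt a)) *\<^sub>R u"
    by (simp add: gap1.adj_isometric_part_eq bounded_op_scaleR[OF op1(2)] bounded_op_scaleR[OF G]
        gap1.inv_sqrt_op_eigenvector[OF A1u pos(1)] mult.commute flip: u_def)
  show "Y1 (X2 v) = (sqrt k' * sqrt a) *\<^sub>R adj W1 (W2 v)"
    using pos by (simp add: w flip: u_def)
  show "Y1 (X1 (adj W1 (W2 v))) = k' *\<^sub>R adj W1 (W2 v)"
    by (simp add: w A1u bounded_op_scaleR[OF op1(1)] bounded_op_scaleR[OF op1(2)])
  have "(norm u)\<^sup>2 = inner (X1 (Y1 (X2 v))) (X2 v)"
    unfolding u_def by (rule adjoint_pair_inner_sq[OF adjoint_pair_sym[OF pair1], symmetric])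
  also have "\<dots> = k' * inner (Y2 (X2 v)) v"
    by (simp add: B1 adjoint_pair_inner_sq[OF pair2] flip: power2_norm_eq_inner)
  also have "\<dots> = (sqrt k' * sqrt a * norm v)\<^sup>2"
    using pos by (simp add: A2v power_mult_distrib power2_norm_eq_inner)
  finally have "norm u = sqrt k' * sqrt a * norm v"
    by (rule power2_eq_imp_eq) (use pos in simp_all)
  then show "norm (adj W1 (W2 v)) = norm v"
    using pos by (simp add: w)
qed

text \<open>\<open>p\<^sub>2\<close> passes through \<open>ker x\<^sub>2\<^sup>*\<close>, on which \<open>x\<^sub>1 x\<^sub>1\<^sup>*\<close> is \<open>1 + c\<close>; the operator \<open>x\<^sub>1\<^sup>*\<close> carries this
  eigenvalue over to \<open>x\<^sub>1\<^sup>* x\<^sub>1\<close>.\<close>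
lemma range_p2_eigenvector:
  "Y1 (X1 (p2 q c t1 \<xi>)) = (1 + c) *\<^sub>R p2 q c t1 \<xi>"
proof -
  note op1 = adjoint_pairD(1,2)[OF pair1] and op2 = adjoint_pairD(1,2)[OF pair2]
  define u where "u = W1 \<xi> - W2 (adj W2 (W1 \<xi>))"
  have "Y2 u = 0"
    by (simp add: u_def bounded_op_diff[OF op2(2)] gap2.range_projection)
  then have "X1 (Y1 u) = (1 + c) *\<^sub>R u"
    using sum_of_ranges[of u] by (simp add: bounded_op_zero[OF op2(1)])
  then have "Y1 (X1 (Y1 u)) = (1 + c) *\<^sub>R Y1 u"
    by (simp add: bounded_op_scaleR[OF op1(2)])
  moreover from this have "inv_sqrt_op (Y1 \<circ> X1) (Y1 u) = (1 / sqrt (1 + c)) *\<^sub>R Y1 u"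
    using c by (intro gap1.inv_sqrt_op_eigenvector) auto
  then have "p2 q c t1 \<xi> = (1 / sqrt (1 + c)) *\<^sub>R Y1 u"
    by (simp add: p2_def gap1.adj_isometric_part_eq flip: u_def)
  ultimately show ?thesis
    by (simp add: bounded_op_scaleR[OF op1(1)] bounded_op_scaleR[OF op1(2)])
qed

text \<open>The recursion contracts towards its fixed point \<open>c\<close> with ratio \<open>1 / q\<^sup>2\<close>. A chain that does not start at
  \<open>c\<close> thus has pairwise distinct eigenvalues, which makes its vectors orthogonal.\<close>
lemma weighted_shift_chain:
  fixes b :: "nat \<Rightarrow> ell2" and d :: "nat \<Rightarrow> real"
  assumes b: "norm (b 0) = 1" "Y1 (X1 (b 0)) = d 0 *\<^sub>R b 0" "\<And>n. b (Suc n) = adj W1 (W2 (b n))"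
    and d: "0 \<le> d 0" "d 0 \<le> 1 + c" "d 0 \<noteq> c" "\<And>n. d (Suc n) = c - c / q\<^sup>2 + d n / q\<^sup>2"
  shows "Y1 (X2 (b n)) = complex_of_real (sqrt (d (Suc n)) * sqrt (1 + c / q\<^sup>2 - d n / q\<^sup>2)) *\<^sub>C b (Suc n)"
    and "weighted_shift_on (closure (ell2.span (range b))) b (Y1 \<circ> X2)"
proof -
  have d_bounds: "0 \<le> d n \<and> d n \<le> 1 + c" for n
  proof (induction n)
    case (Suc n)
    have "0 \<le> d n / q\<^sup>2" "d n / q\<^sup>2 \<le> (1 + c) / q\<^sup>2"
      using Suc by (simp_all add: divide_right_mono)
    then show ?case using q_sq unfolding d(4) add_divide_distrib by linarith
  qed (use d in simp)
  have d_closed: "d n = c + (d 0 - c) * (1 / q\<^sup>2) ^ n" for n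
    by (induction n) (simp_all add: d(4) add_divide_distrib diff_divide_distrib)
  have d_inj: "d m \<noteq> d n" if "m \<noteq> n" for m n
    using power_inject_exp'[of "1 / q\<^sup>2" m n] q_sq that d(3) d_closed[of m] d_closed[of n] by auto
  have ev: "norm (b n) = 1 \<and> Y1 (X1 (b n)) = d n *\<^sub>R b n" for n
  proof (induction n)
    case (Suc n)
    then show ?case
      using eigenvector_step(2,3)[of "b n" "d n"] d_bounds[of n] by (simp add: b(3) d(4))
  qed (simp add: b)
  show shift: "Y1 (X2 (b n)) = complex_of_real (sqrt (d (Suc n)) * sqrt (1 + c / q\<^sup>2 - d n / q\<^sup>2)) *\<^sub>C b (Suc n)" for n
    using eigenvector_step(1)[of "b n" "d n"] ev[of n] d_bounds[of n]
    unfolding scaleC_of_real b(3) d(4) by simp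
  have "cinner (b m) (b n) = of_bool (m = n)" for m n
  proof (cases "m = n")
    case True
    then show ?thesis using ev by (simp add: cinner_self)
  next
    case False
    then show ?thesis
      using eigenvectors_orthogonal[OF gap1.comp_selfadjoint, of "b m" "d m" "b n" "d n"]
        ev d_inj[OF False] by simp
  qed
  then show "weighted_shift_on (closure (ell2.span (range b))) b (Y1 \<circ> X2)"
    using bounded_op_comp[OF adjoint_pairD(2)[OF pair1] adjoint_pairD(1)[OF pair2]]
    by (intro weighted_shift_onI[where w = "\<lambda>n. complex_of_real
        (sqrt (d (Suc n)) * sqrt (1 + c / q\<^sup>2 - d n / q\<^sup>2))"]) (simp_all only: o_def shift)
qed

end

theorem corollary2:
  fixes q c :: real and t1 :: complex
    and v :: "nat \<Rightarrow> ell2" and cs :: "nat \<Rightarrow> real" and H1 H2 :: "ell2 set"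
  assumes "q > 1" and "c > 0" and "cmod t1 = 1"
    and "norm (v 1) = 1" and "{\<xi>. x1 q c t1 \<xi> = 0} = ell2.span {v 1}"
    and "norm (v 2) = 1" and "range (p2 q c t1) = ell2.span {v 2}"
    and "\<And>i n. i \<in> {1, 2} \<Longrightarrow> v (i + 2 * n) = ((adj (x1t q c t1) \<circ> x2t q c t1) ^^ n) (v i)"
    and "H1 = closure (ell2.span {v (1 + 2 * n) | n. True})"
    and "H2 = closure (ell2.span {v (2 + 2 * n) | n. True})"
    and "cs 1 = 0" and "cs 2 = 1 + c"
    and "\<And>k. k \<ge> 1 \<Longrightarrow> cs (k + 2) = c - c / q\<^sup>2 + cs k / q\<^sup>2"
  shows "adj (x1 q c t1) \<circ> x2 q c t1 =
           sqrt_op (adj (x1 q c t1) \<circ> x1 q c t1) \<circ> (adj (x1t q c t1) \<circ> x2t q c t1)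
             \<circ> sqrt_op (adj (x2 q c t1) \<circ> x2 q c t1)
       \<and> weighted_shift_on H1 (\<lambda>n. v (1 + 2 * n)) (adj (x1 q c t1) \<circ> x2 q c t1)
       \<and> weighted_shift_on H2 (\<lambda>n. v (2 + 2 * n)) (adj (x1 q c t1) \<circ> x2 q c t1)
       \<and> (\<forall>k\<ge>1. (adj (x1 q c t1) \<circ> x2 q c t1) (v k) =
             complex_of_real (sqrt (cs (k + 2)) * sqrt (1 + c / q\<^sup>2 - cs k / q\<^sup>2)) *\<^sub>C v (k + 2))"
proof -
  interpret x_operators q c t1
    by unfold_locales (use assms(1-3) in auto)
  have adj1: "adj X1 = Y1" and adj2: "adj X2 = Y2"
    by (rule adj_eqI[OF pair1], rule adj_eqI[OF pair2])
  have step: "v (i + 2 * Suc n) = adj W1 (W2 (v (i + 2 * n)))" if "i \<in> {1, 2}" for i n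
    using assms(8)[OF that, of n] assms(8)[OF that, of "Suc n"] by simp
  have rec: "cs (i + 2 * Suc n) = c - c / q\<^sup>2 + cs (i + 2 * n) / q\<^sup>2" if "i \<in> {1, 2}" for i n
    using assms(13)[of "i + 2 * n"] that by (auto simp: add.assoc add.commute)
  have ev1: "Y1 (X1 (v 1)) = 0 *\<^sub>R v 1"
  proof -
    have "v 1 \<in> {\<xi>. X1 \<xi> = 0}"
      unfolding assms(5) by (rule ell2.span_base) simp
    then show ?thesis
      by (simp add: bounded_op_zero[OF adjoint_pairD(2)[OF pair1]])
  qed
  have ev2: "Y1 (X1 (v 2)) = (1 + c) *\<^sub>R v 2"
  proof -
    have "v 2 \<in> range (p2 q c t1)"
      unfolding assms(7) by (rule ell2.span_base) simp
    then show ?thesis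
      using range_p2_eigenvector by auto
  qed
  have chain: "Y1 (X2 (v (i + 2 * n))) = complex_of_real (sqrt (cs (i + 2 * Suc n))
        * sqrt (1 + c / q\<^sup>2 - cs (i + 2 * n) / q\<^sup>2)) *\<^sub>C v (i + 2 * Suc n)"
    "weighted_shift_on (closure (ell2.span (range (\<lambda>n. v (i + 2 * n))))) (\<lambda>n. v (i + 2 * n)) (Y1 \<circ> X2)"
    if i: "i \<in> {1, 2}" for i n
  proof -
    have "norm (v (i + 2 * 0)) = 1" "Y1 (X1 (v (i + 2 * 0))) = cs (i + 2 * 0) *\<^sub>R v (i + 2 * 0)"
      "0 \<le> cs (i + 2 * 0)" "cs (i + 2 * 0) \<le> 1 + c" "cs (i + 2 * 0) \<noteq> c"
      using i assms(2,4,6,11,12) ev1 ev2 by auto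
    note facts = this(1,2) step[OF i] this(3-5) rec[OF i]
    show "Y1 (X2 (v (i + 2 * n))) = complex_of_real (sqrt (cs (i + 2 * Suc n))
        * sqrt (1 + c / q\<^sup>2 - cs (i + 2 * n) / q\<^sup>2)) *\<^sub>C v (i + 2 * Suc n)"
      by (rule weighted_shift_chain(1)[where b = "\<lambda>n. v (i + 2 * n)" and d = "\<lambda>n. cs (i + 2 * n)", OF facts])
    show "weighted_shift_on (closure (ell2.span (range (\<lambda>n. v (i + 2 * n))))) (\<lambda>n. v (i + 2 * n)) (Y1 \<circ> X2)"
      by (rule weighted_shift_chain(2)[where b = "\<lambda>n. v (i + 2 * n)" and d = "\<lambda>n. cs (i + 2 * n)", OF facts])
  qed
  have ranges: "{f n | n. True} = range f" for f :: "nat \<Rightarrow> ell2"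
    by auto
  have formula: "Y1 (X2 (v k)) = complex_of_real (sqrt (cs (k + 2)) * sqrt (1 + c / q\<^sup>2 - cs k / q\<^sup>2)) *\<^sub>C v (k + 2)"
    if k: "k \<ge> 1" for k
  proof -
    define i where "i = (if odd k then 1 else 2 :: nat)"
    obtain n where n: "k = i + 2 * n"
    proof
      show "k = i + 2 * ((k - i) div 2)"
        using k by (auto simp: i_def elim!: oddE evenE)
    qed
    have "i \<in> {1, 2}" by (simp add: i_def)
    from chain(1)[OF this, of n] show ?thesis
      by (simp add: n ac_simps)
  qed
  have "Y1 \<circ> X2 = sqrt_op (Y1 \<circ> X1) \<circ> (adj W1 \<circ> W2) \<circ> sqrt_op (Y2 \<circ> X2)"
    by (simp add: fun_eq_iff factorization)
  moreover have "weighted_shift_on H1 (\<lambda>n. v (1 + 2 * n)) (Y1 \<circ> X2)"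
    unfolding assms(9) ranges by (rule chain(2)) simp
  moreover have "weighted_shift_on H2 (\<lambda>n. v (2 + 2 * n)) (Y1 \<circ> X2)"
    unfolding assms(10) ranges by (rule chain(2)) simp
  moreover have "\<forall>k\<ge>1. (Y1 \<circ> X2) (v k) =
      complex_of_real (sqrt (cs (k + 2)) * sqrt (1 + c / q\<^sup>2 - cs k / q\<^sup>2)) *\<^sub>C v (k + 2)"
    unfolding comp_apply using formula by blast
  ultimately show ?thesis
    unfolding adj1 adj2 by blast
qed

end
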